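(* Let $l>0$ and let $E\subset\mathbb{R}^2$ be a bounded convex set with nonempty interior and $P(E)=l$. Then $$\inf_{x_0\in\mathbb{R}^2}\int_{\partial E}|x-x_0|^2\,d\mu_E<\frac{\pi}{8}l^2,$$ and the inequality is sharp, i.e. the supremum of the left-hand side over all such $E$ with $P(E)=l$ equals $\frac{\pi}{8}l^2$.
   Context: $P(E)$ is the perimeter of $E$. $\mu_E$ is the curvature measure of the planar convex set $E$: the Radon measure supported on $\partial E$ such that $\mu_E(A)$ is the $\mathcal{H}^1$-measure of the set of unit vectors that are outer normals to $E$ at some point of $A\cap\partial E$; for $E$ of class $C^2$, $\mu_E=H_{\partial E}\,\mathcal{H}^1$ on $\partial E$ with $H_{\partial E}$ the curvature. *)

theory Defs
  imports "HOL-Analysis.Analysis"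
begin

text \<open>
  One-dimensional Hausdorff (outer) measure. In dimension one the usual normalising constant is 1,
  so a line segment gets its length. Boundedness of the covering sets has to be required explicitly
  because \<^const>\<open>diameter\<close> is an unspecified value on unbounded sets.
\<close>

definition hausdorff1 :: "'a::metric_space set \<Rightarrow> ennreal" where
  "hausdorff1 A =
     (SUP \<delta>\<in>{0::real<..}.
        INF U\<in>{U :: nat \<Rightarrow> 'a set. A \<subseteq> (\<Union>i. U i) \<and> (\<forall>i. bounded (U i) \<and> diameter (U i) \<le> \<delta>)}.
          (\<Sum>i. ennreal (diameter (U i))))"

text \<open>
  The perimeter of a planar convex set with nonempty interior is the length of its boundary.
\<close>

definition perimeter :: "(real^2) set \<Rightarrow> ennreal" where
  "perimeter E = hausdorff1 (frontier E)"

definition outer_normals :: "(real^2) set \<Rightarrow> real^2 \<Rightarrow> (real^2) set" where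
  "outer_normals E x = {u. norm u = 1 \<and> (\<forall>y\<in>E. u \<bullet> (y - x) \<le> 0)}"

text \<open>
  The curvature measure, as a Borel measure on the whole plane. For convex \<open>E\<close> the set function
  below is countably additive on Borel sets: a unit vector that is normal to \<open>E\<close> at two different
  boundary points is normal to \<open>E\<close> along a nondegenerate boundary segment, and there are only
  countably many such vectors. So \<^const>\<open>measure_of\<close> does not fall back to the zero measure.
\<close>

definition curvature_measure :: "(real^2) set \<Rightarrow> (real^2) measure" where
  "curvature_measure E =
     measure_of UNIV (sets borel) (\<lambda>A. hausdorff1 (\<Union>x\<in>A \<inter> frontier E. outer_normals E x))"

end

theory Submission
  imports Defs
begin

text \<open>
  The upper bound comes from the fact that \<open>\<partial>E\<close> lies in a disc of radius strictly less than
  \<open>l / 4\<close>. If \<open>m\<close> is the centre of such a disc and \<open>\<rho> < l / 4\<close> its radius, then the integral with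
  \<open>x\<^sub>0 = m\<close> is at most \<open>\<rho>\<^sup>2\<close> times the total curvature, and the total curvature is at most the length
  \<open>2 \<pi>\<close> of the unit circle; this gives \<open>2 \<pi> \<rho>\<^sup>2 < \<pi> l\<^sup>2 / 8\<close>.

  By Helly's theorem the disc exists as soon as any three points of \<open>closure E\<close> lie in a common disc
  of one fixed radius below \<open>l / 4\<close>, and by compactness of \<open>(closure E)\<^sup>3\<close> the radius may depend
  on the triple (\<open>uniform_triple_radius\<close>, \<open>helly_cball_plane\<close>). Three non-collinear points
  \<open>a, b, c\<close> span a triangle of perimeter \<open>P \<le> l\<close>: the nearest point projection onto the triangle is
  1-Lipschitz and maps \<open>\<partial>E\<close> onto a superset of the boundary of the triangle
  (\<open>hausdorff1_frontier_mono\<close>). Let \<open>q\<close> be the point on \<open>bc\<close> such that \<open>a\<close> and \<open>q\<close> halve the perimeter,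
  and \<open>m\<close> the midpoint of \<open>aq\<close>. A vertex \<open>x\<close> on one of the two halves satisfies
  \<open>|x - m| \<le> (|x - a| + |x - q|) / 2 \<le> P / 4\<close>, strictly because the triangle is nondegenerate
  (\<open>triangle_in_quarter_perimeter_ball\<close>). Collinear points lie in the disc whose diameter is the
  longest of their segments, and twice that diameter is less than \<open>l\<close> since \<open>E\<close> contains
  a point off the line.

  For sharpness, the rectangle with half-sides \<open>w\<close> and \<open>h\<close>, \<open>w + h = l / 4\<close>, has curvature measure
  \<open>\<pi> / 2\<close> at each corner and zero elsewhere, up to the four normals of the sides, which form a null
  set (\<open>curvature_measure_rectangle\<close>). The integral is therefore a sum over four centrally symmetric
  points; it is minimal at the centre, where it is \<open>2 \<pi> (w\<^sup>2 + h\<^sup>2) \<ge> 2 \<pi> w\<^sup>2\<close>. As \<open>w\<close> tends to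
  \<open>l / 4\<close> this tends to \<open>\<pi> l\<^sup>2 / 8\<close>.

  All lengths are one-dimensional Hausdorff measures. Lipschitz maps and subadditivity bound them from
  above. For lower bounds the covering property of Lebesgue measure gives the length of intervals, maps
  that do not contract small distances transport it to segments and circular arcs, and disjoint compact
  pieces add up (\<open>hausdorff1_UN_arcs_eq\<close>).
\<close>

section \<open>Hausdorff measure under unions and Lipschitz maps\<close>

definition fine_covers :: "real \<Rightarrow> 'a::metric_space set \<Rightarrow> (nat \<Rightarrow> 'a set) set" where
  "fine_covers \<delta> A =
     {U. A \<subseteq> (\<Union>i. U i) \<and> (\<forall>i. bounded (U i) \<and> diameter (U i) \<le> \<delta>)}"

definition hausdorff1_scale :: "real \<Rightarrow> 'a::metric_space set \<Rightarrow> ennreal" where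
  "hausdorff1_scale \<delta> A = (INF U\<in>fine_covers \<delta> A. \<Sum>i. ennreal (diameter (U i)))"

lemma hausdorff1_eq: "hausdorff1 A = (SUP \<delta>\<in>{0<..}. hausdorff1_scale \<delta> A)"
  unfolding hausdorff1_def hausdorff1_scale_def fine_covers_def ..

lemma fine_coversD:
  assumes "U \<in> fine_covers \<delta> A"
  shows "A \<subseteq> (\<Union>i. U i)" "bounded (U i)" "diameter (U i) \<le> \<delta>"
  using assms by (auto simp: fine_covers_def)

lemma hausdorff1_scale_le:
  "U \<in> fine_covers \<delta> A \<Longrightarrow> hausdorff1_scale \<delta> A \<le> (\<Sum>i. ennreal (diameter (U i)))"
  unfolding hausdorff1_scale_def by (rule INF_lower)

lemma hausdorff1_scale_le_hausdorff1:
  "\<delta> > 0 \<Longrightarrow> hausdorff1_scale \<delta> A \<le> hausdorff1 A"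
  unfolding hausdorff1_eq by (rule SUP_upper) auto

lemma hausdorff1_leI:
  assumes "\<And>\<delta>. \<delta> > 0 \<Longrightarrow> hausdorff1_scale \<delta> A \<le> c"
  shows "hausdorff1 A \<le> c"
  unfolding hausdorff1_eq using assms by (intro SUP_least) auto

lemma fine_cover_near_optimal:
  assumes "hausdorff1_scale \<delta> A < c"
  obtains U where "U \<in> fine_covers \<delta> A" "(\<Sum>i. ennreal (diameter (U i))) < c"
  using assms unfolding hausdorff1_scale_def INF_less_iff by blast

lemma fine_covers_mono: "A \<subseteq> B \<Longrightarrow> fine_covers \<delta> B \<subseteq> fine_covers \<delta> A"
  by (auto simp: fine_covers_def)

lemma hausdorff1_mono: "A \<subseteq> B \<Longrightarrow> hausdorff1 A \<le> hausdorff1 B"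
  unfolding hausdorff1_eq hausdorff1_scale_def
  by (intro SUP_subset_mono order_refl INF_superset_mono fine_covers_mono)

text \<open>
  Used to merge the covers of two sets into one sequence.
\<close>

lemma suminf_interleave_le:
  fixes f g :: "nat \<Rightarrow> ennreal"
  shows "(\<Sum>i. if even i then f (i div 2) else g (i div 2)) \<le> (\<Sum>i. f i) + (\<Sum>i. g i)"
    (is "suminf ?h \<le> _")
proof (rule suminf_le_const)
  fix n
  have double: "sum ?h {..<2*n} = sum f {..<n} + sum g {..<n}"
    by (induction n) (auto simp: algebra_simps)
  have "sum ?h {..<n} \<le> sum ?h {..<2*n}"
    by (intro sum_mono2) auto
  also have "\<dots> \<le> (\<Sum>i. f i) + (\<Sum>i. g i)"
    unfolding double by (intro add_mono sum_le_suminf) auto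
  finally show "sum ?h {..<n} \<le> (\<Sum>i. f i) + (\<Sum>i. g i)" .
qed auto

lemma hausdorff1_Un_le: "hausdorff1 (A \<union> B) \<le> hausdorff1 A + hausdorff1 B"
proof (cases "hausdorff1 A = \<infinity> \<or> hausdorff1 B = \<infinity>")
  case True
  then show ?thesis by auto
next
  case False
  show ?thesis
  proof (rule hausdorff1_leI)
    fix \<delta> :: real assume "\<delta> > 0"
    show "hausdorff1_scale \<delta> (A \<union> B) \<le> hausdorff1 A + hausdorff1 B"
    proof (rule ennreal_le_epsilon)
      fix e :: real assume "e > 0"
      have near: "\<exists>U\<in>fine_covers \<delta> S. (\<Sum>i. ennreal (diameter (U i))) < hausdorff1 S + ennreal (e/2)"
        if "hausdorff1 S \<noteq> \<infinity>" for S :: "'a set"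
      proof -
        have "hausdorff1 S < hausdorff1 S + ennreal (e/2)"
          using that \<open>e > 0\<close>
          by (cases "hausdorff1 S") (auto simp flip: ennreal_plus intro: ennreal_lessI)
        then have "hausdorff1_scale \<delta> S < hausdorff1 S + ennreal (e/2)"
          using hausdorff1_scale_le_hausdorff1[OF \<open>\<delta> > 0\<close>] by (rule le_less_trans[rotated])
        then show ?thesis
          by (metis fine_cover_near_optimal)
      qed
      obtain U where U: "U \<in> fine_covers \<delta> A"
        "(\<Sum>i. ennreal (diameter (U i))) < hausdorff1 A + ennreal (e/2)"
        using near[of A] False by auto
      obtain V where V: "V \<in> fine_covers \<delta> B"
        "(\<Sum>i. ennreal (diameter (V i))) < hausdorff1 B + ennreal (e/2)"
        using near[of B] False by auto
      define W where "W i = (if even i then U (i div 2) else V (i div 2))" for i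
      have "x \<in> (\<Union>i. W i)" if x: "x \<in> A \<union> B" for x
      proof -
        have W_even: "U i = W (2*i)" and W_odd: "V i = W (2*i+1)" for i
          by (auto simp: W_def)
        obtain i where "x \<in> U i \<or> x \<in> V i"
          using x subsetD[OF fine_coversD(1)[OF U(1)], of x] subsetD[OF fine_coversD(1)[OF V(1)], of x]
          by blast
        then show ?thesis
          using W_even[of i] W_odd[of i] by blast
      qed
      moreover have "bounded (W i)" "diameter (W i) \<le> \<delta>" for i
        using fine_coversD(2,3)[OF U(1)] fine_coversD(2,3)[OF V(1)] by (auto simp: W_def)
      ultimately have W: "W \<in> fine_covers \<delta> (A \<union> B)"
        unfolding fine_covers_def by blast
      have "hausdorff1_scale \<delta> (A \<union> B) \<le> (\<Sum>i. ennreal (diameter (W i)))"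
        by (rule hausdorff1_scale_le[OF W])
      also have "\<dots> = (\<Sum>i. if even i then ennreal (diameter (U (i div 2)))
                             else ennreal (diameter (V (i div 2))))"
        by (intro suminf_cong) (simp add: W_def)
      also have "\<dots> \<le> (\<Sum>i. ennreal (diameter (U i))) + (\<Sum>i. ennreal (diameter (V i)))"
        by (rule suminf_interleave_le)
      also have "\<dots> \<le> (hausdorff1 A + ennreal (e/2)) + (hausdorff1 B + ennreal (e/2))"
        using U(2) V(2) by (intro add_mono) auto
      also have "\<dots> = hausdorff1 A + hausdorff1 B + (ennreal (e/2) + ennreal (e/2))"
        by (simp add: algebra_simps)
      also have "ennreal (e/2) + ennreal (e/2) = ennreal e"
        using \<open>e > 0\<close> by (simp flip: ennreal_plus)
      finally show "hausdorff1_scale \<delta> (A \<union> B) \<le> hausdorff1 A + hausdorff1 B + ennreal e" .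
    qed
  qed
qed

lemma hausdorff1_singleton: "hausdorff1 {x} = 0"
proof -
  have "hausdorff1 {x} \<le> 0"
  proof (rule hausdorff1_leI)
    fix \<delta> :: real assume "\<delta> > 0"
    then have "(\<lambda>_. {x}) \<in> fine_covers \<delta> {x}"
      by (auto simp: fine_covers_def)
    then show "hausdorff1_scale \<delta> {x} \<le> 0"
      using hausdorff1_scale_le by fastforce
  qed
  then show ?thesis by simp
qed

lemma hausdorff1_empty [simp]: "hausdorff1 {} = 0"
  using hausdorff1_mono[of "{}" "{undefined}"] by (simp add: hausdorff1_singleton)

lemma hausdorff1_UN_le:
  assumes "finite I"
  shows "hausdorff1 (\<Union>i\<in>I. A i) \<le> (\<Sum>i\<in>I. hausdorff1 (A i))"
  using assms
proof (induction I)
  case (insert i I)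
  have "hausdorff1 (\<Union>j\<in>insert i I. A j) \<le> hausdorff1 (A i) + hausdorff1 (\<Union>j\<in>I. A j)"
    using hausdorff1_Un_le[of "A i" "\<Union>j\<in>I. A j"] by simp
  also have "\<dots> \<le> hausdorff1 (A i) + (\<Sum>j\<in>I. hausdorff1 (A j))"
    by (intro add_left_mono insert.IH)
  finally show ?case using insert by simp
qed simp

lemma hausdorff1_finite: "finite A \<Longrightarrow> hausdorff1 A = 0"
  using hausdorff1_UN_le[of A "\<lambda>x. {x}"] by (simp add: hausdorff1_singleton)

text \<open>
  The Lipschitz condition is only asked at distances up to \<open>\<epsilon>\<close>, since covers by small sets see no
  larger ones. This lets inverses of arcs qualify whose endpoints come close to each other, with a
  constant \<open>C\<close> as near to 1 as desired.
\<close>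

lemma hausdorff1_lipschitz_image:
  assumes "\<epsilon> > 0" "C > 0"
    and lip: "\<And>x y. x \<in> A \<Longrightarrow> y \<in> A \<Longrightarrow> dist x y \<le> \<epsilon> \<Longrightarrow> dist (f x) (f y) \<le> C * dist x y"
  shows "hausdorff1 (f ` A) \<le> ennreal C * hausdorff1 A"
proof (rule hausdorff1_leI)
  fix \<delta> :: real assume "\<delta> > 0"
  \<comment> \<open>Sets of diameter at most \<open>\<eta>\<close> have images of diameter at most \<open>C * \<eta> \<le> \<delta>\<close>.\<close>
  define \<eta> where "\<eta> = min \<epsilon> (\<delta> / (C + 1))"
  have "\<eta> > 0" "\<eta> \<le> \<epsilon>"
    using \<open>\<delta> > 0\<close> assms by (auto simp: \<eta>_def)
  have "C * \<eta> \<le> (C+1) * (\<delta> / (C + 1))"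
    using \<open>\<delta> > 0\<close> \<open>\<eta> > 0\<close> assms by (intro mult_mono) (auto simp: \<eta>_def)
  then have C\<eta>: "C * \<eta> \<le> \<delta>"
    using \<open>C > 0\<close> by (simp add: add_nonneg_eq_0_iff)
  \<comment> \<open>The factor \<open>C\<close> is moved to the other side so that the infimum over covers can be taken.\<close>
  have cancel: "ennreal (1/C) * (ennreal C * x) = x" for x
    using \<open>C > 0\<close> by (simp flip: mult.assoc ennreal_mult)
  have "hausdorff1_scale \<delta> (f ` A) \<le> ennreal C * hausdorff1_scale \<eta> A"
  proof -
    have "hausdorff1_scale \<delta> (f ` A) \<le> ennreal C * (\<Sum>i. ennreal (diameter (U i)))"
      if U: "U \<in> fine_covers \<eta> A" for U
    proof -
      define V where "V i = f ` (A \<inter> U i)" for i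
      have dist_V: "dist x y \<le> C * diameter (U i)" if xy: "x \<in> V i" "y \<in> V i" for x y i
      proof -
        obtain a b where ab: "a \<in> A" "b \<in> A" "a \<in> U i" "b \<in> U i" "x = f a" "y = f b"
          using xy by (auto simp: V_def)
        have "dist a b \<le> diameter (U i)"
          using fine_coversD(2)[OF U] ab by (intro diameter_bounded_bound) auto
        moreover have "diameter (U i) \<le> \<epsilon>"
          using fine_coversD(3)[OF U, of i] \<open>\<eta> \<le> \<epsilon>\<close> by linarith
        ultimately show ?thesis
          using lip[of a b] ab \<open>C > 0\<close>
          by (smt (verit) mult_left_mono)
      qed
      have nonneg: "0 \<le> C * diameter (U i)" for i
        using diameter_ge_0[OF fine_coversD(2)[OF U]] \<open>C > 0\<close> by simp
      have diam_V: "diameter (V i) \<le> C * diameter (U i)" for i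
      proof (cases "V i = {}")
        case False
        have "diameter (V i) = (SUP (x,y)\<in>V i \<times> V i. dist x y)"
          using False by (simp add: diameter_def)
        also have "\<dots> \<le> C * diameter (U i)"
          using False dist_V by (intro cSUP_least) auto
        finally show ?thesis .
      qed (use nonneg in auto)
      have "bounded (V i)" for i
        unfolding bounded_two_points using dist_V by blast
      moreover have "diameter (V i) \<le> \<delta>" for i
        using diam_V[of i] mult_left_mono[OF fine_coversD(3)[OF U, of i], of C] \<open>C > 0\<close> C\<eta> by linarith
      moreover have "f ` A \<subseteq> (\<Union>i. V i)"
        using fine_coversD(1)[OF U] by (force simp: V_def)
      ultimately have "V \<in> fine_covers \<delta> (f ` A)"
        by (auto simp: fine_covers_def)
      then have "hausdorff1_scale \<delta> (f ` A) \<le> (\<Sum>i. ennreal (diameter (V i)))"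
        by (rule hausdorff1_scale_le)
      also have "\<dots> \<le> (\<Sum>i. ennreal C * ennreal (diameter (U i)))"
        using diam_V diameter_ge_0[OF fine_coversD(2)[OF U]] \<open>C > 0\<close>
        by (intro suminf_le) (auto simp flip: ennreal_mult intro: ennreal_leI)
      finally show ?thesis by simp
    qed
    then have bound: "ennreal (1/C) * hausdorff1_scale \<delta> (f ` A) \<le> (\<Sum>i. ennreal (diameter (U i)))"
      if "U \<in> fine_covers \<eta> A" for U
      using mult_left_mono[OF _ zero_le, of _ _ "ennreal (1/C)"] that cancel
      by (metis (no_types, lifting) mult.commute mult.assoc)
    have "ennreal (1/C) * hausdorff1_scale \<delta> (f ` A) \<le> hausdorff1_scale \<eta> A"
      unfolding hausdorff1_scale_def[of \<eta>] by (intro INF_greatest bound)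
    then show ?thesis
      using mult_left_mono[OF _ zero_le, of _ _ "ennreal C"] cancel
      by (metis (no_types, lifting) mult.commute mult.assoc)
  qed
  also have "\<dots> \<le> ennreal C * hausdorff1 A"
    by (intro mult_left_mono hausdorff1_scale_le_hausdorff1 \<open>\<eta> > 0\<close>) auto
  finally show "hausdorff1_scale \<delta> (f ` A) \<le> ennreal C * hausdorff1 A" .
qed

text \<open>
  The condition makes \<open>f\<close> injective, and its inverse is \<open>C\<close>-Lipschitz at small distances.
\<close>

lemma hausdorff1_le_expanding_image:
  assumes "\<epsilon> > 0" "C > 0"
    and exp: "\<And>x y. x \<in> A \<Longrightarrow> y \<in> A \<Longrightarrow> dist (f x) (f y) \<le> \<epsilon> \<Longrightarrow> dist x y \<le> C * dist (f x) (f y)"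
  shows "hausdorff1 A \<le> ennreal C * hausdorff1 (f ` A)"
proof -
  have inj: "inj_on f A"
  proof (rule inj_onI)
    fix x y assume "x \<in> A" "y \<in> A" "f x = f y"
    then show "x = y" using exp[of x y] \<open>\<epsilon> > 0\<close> by simp
  qed
  have "hausdorff1 (inv_into A f ` f ` A) \<le> ennreal C * hausdorff1 (f ` A)"
    using assms(1,2) exp inj by (intro hausdorff1_lipschitz_image[of \<epsilon>]) auto
  then show ?thesis using inj by simp
qed

lemma hausdorff1_interval_le:
  fixes a b :: real
  assumes "a \<le> b"
  shows "hausdorff1 {a..b} \<le> ennreal (b - a)"
proof (rule hausdorff1_leI)
  fix \<delta> :: real assume "\<delta> > 0"
  obtain n where n: "real n > (b - a) / \<delta>"
    using reals_Archimedean2 by blast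
  then have "n > 0"
    using assms \<open>\<delta> > 0\<close> by (cases n) (auto simp: divide_less_0_iff)
  define h where "h = (b - a) / n"
  have h: "0 \<le> h" "h \<le> \<delta>" "n * h = b - a"
    using n \<open>n > 0\<close> assms \<open>\<delta> > 0\<close> by (auto simp: h_def field_simps)
  define U where "U i = (if i < n then {a + real i * h .. a + real (Suc i) * h} else {})" for i
  have diam: "diameter (U i) = (if i < n then h else 0)" for i
    using h(1) by (simp add: U_def algebra_simps)
  have "{a..a + real k * h} \<subseteq> (\<Union>i<k. {a + real i * h .. a + real (Suc i) * h})" if "k > 0" for k
    using that
  proof (induction k)
    case (Suc k)
    show ?case
    proof (cases "k = 0")
      case False
      have "{a..a + real (Suc k) * h} \<subseteq> {a..a + real k * h} \<union> {a + real k * h .. a + real (Suc k) * h}"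
        by auto
      then show ?thesis
        using Suc.IH False by (auto simp: lessThan_Suc)
    qed (simp add: lessThan_Suc)
  qed simp
  from this[OF \<open>n > 0\<close>] have "{a..b} \<subseteq> (\<Union>i. U i)"
    unfolding h(3) U_def by force
  then have "U \<in> fine_covers \<delta> {a..b}"
    using h \<open>\<delta> > 0\<close> unfolding fine_covers_def by (auto simp: diam) (auto simp: U_def)
  then have "hausdorff1_scale \<delta> {a..b} \<le> (\<Sum>i. ennreal (diameter (U i)))"
    by (rule hausdorff1_scale_le)
  also have "\<dots> = (\<Sum>i<n. ennreal h)"
    by (subst suminf_finite[of "{..<n}"]) (auto simp: diam)
  also have "\<dots> = ennreal (b - a)"
    using h by (simp add: ennreal_of_nat_eq_real_of_nat flip: ennreal_mult)
  finally show "hausdorff1_scale \<delta> {a..b} \<le> ennreal (b - a)" .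
qed

text \<open>
  Each covering set lies in the interval between its infimum and supremum, whose length is its diameter;
  so countable subadditivity of Lebesgue measure bounds the sum of the diameters.
\<close>

lemma hausdorff1_interval_ge:
  fixes a b :: real
  shows "ennreal (b - a) \<le> hausdorff1 {a..b}"
proof -
  have "ennreal (b - a) \<le> hausdorff1_scale 1 {a..b}"
    unfolding hausdorff1_scale_def
  proof (rule INF_greatest)
    fix U assume U: "U \<in> fine_covers 1 {a..b}"
    define J where "J i = (if U i = {} then {} else {Inf (U i) .. Sup (U i)})" for i
    have sub: "U i \<subseteq> J i" for i
      using fine_coversD(2)[OF U, of i]
      by (auto simp: J_def intro!: cInf_lower cSup_upper bounded_imp_bdd_above bounded_imp_bdd_below)
    have cover: "{a..b} \<subseteq> (\<Union>i. J i)"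
      by (rule order_trans[OF fine_coversD(1)[OF U] UN_mono]) (use sub in auto)
    have meas: "emeasure lborel (J i) \<le> ennreal (diameter (U i))" for i
    proof (cases "U i = {}")
      case False
      have bdd: "bdd_above (U i)" "bdd_below (U i)"
        using fine_coversD(2)[OF U] by (simp_all add: bounded_imp_bdd_above bounded_imp_bdd_below)
      have "Sup (U i) \<le> Inf (U i) + diameter (U i)"
      proof (rule cSup_least[OF False])
        fix x assume x: "x \<in> U i"
        have "x - diameter (U i) \<le> Inf (U i)"
        proof (rule cInf_greatest[OF False])
          fix y assume "y \<in> U i"
          then have "dist x y \<le> diameter (U i)"
            using x fine_coversD(2)[OF U] by (intro diameter_bounded_bound)
          then show "x - diameter (U i) \<le> y" by (simp add: dist_real_def)
        qed
        then show "x \<le> Inf (U i) + diameter (U i)" by simp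
      qed
      moreover have "Inf (U i) \<le> Sup (U i)"
        using False bdd by (intro cInf_le_cSup)
      ultimately show ?thesis
        using False by (simp add: J_def ennreal_leI)
    qed (simp add: J_def)
    have "ennreal (b - a) \<le> emeasure lborel {a..b}"
      by (cases "a \<le> b") (auto simp: ennreal_neg)
    also have "\<dots> \<le> emeasure lborel (\<Union>i. J i)"
      using cover by (intro emeasure_mono) (auto simp: J_def)
    also have "\<dots> \<le> (\<Sum>i. emeasure lborel (J i))"
      by (intro emeasure_subadditive_countably) (auto simp: J_def)
    also have "\<dots> \<le> (\<Sum>i. ennreal (diameter (U i)))"
      by (intro suminf_le meas) auto
    finally show "ennreal (b - a) \<le> (\<Sum>i. ennreal (diameter (U i)))" .
  qed
  also have "\<dots> \<le> hausdorff1 {a..b}"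
    by (rule hausdorff1_scale_le_hausdorff1) simp
  finally show ?thesis .
qed

text \<open>
  A set of diameter less than \<open>d\<close> meets only one of \<open>A\<close> and \<open>B\<close>, so a fine cover of the union
  splits into a cover of \<open>A\<close> and a cover of \<open>B\<close>.
\<close>

lemma hausdorff1_Un_separated_ge:
  fixes A B :: "'a::metric_space set"
  assumes "d > 0" and sep: "\<And>x y. x \<in> A \<Longrightarrow> y \<in> B \<Longrightarrow> d \<le> dist x y"
  shows "hausdorff1 A + hausdorff1 B \<le> hausdorff1 (A \<union> B)"
proof -
  have scale: "hausdorff1_scale \<delta> A + hausdorff1_scale \<epsilon> B \<le> hausdorff1 (A \<union> B)"
    if "\<delta> > 0" "\<epsilon> > 0" for \<delta> \<epsilon>
  proof -
    define \<eta> where "\<eta> = min (d/2) (min \<delta> \<epsilon>)"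
    have \<eta>: "0 < \<eta>" "\<eta> < d" "\<eta> \<le> \<delta>" "\<eta> \<le> \<epsilon>"
      using that \<open>d > 0\<close> by (auto simp: \<eta>_def)
    have "hausdorff1_scale \<delta> A + hausdorff1_scale \<epsilon> B \<le> (\<Sum>i. ennreal (diameter (U i)))"
      if U: "U \<in> fine_covers \<eta> (A \<union> B)" for U
    proof -
      note bdd = fine_coversD(2)[OF U]
      have restrict: "(\<lambda>i. U i \<inter> S) \<in> fine_covers \<zeta> S" if "S \<subseteq> A \<union> B" "\<eta> \<le> \<zeta>" for S \<zeta>
      proof -
        have "diameter (U i \<inter> S) \<le> \<zeta>" for i
          using diameter_subset[of "U i \<inter> S" "U i"] bdd[of i] fine_coversD(3)[OF U, of i] that by simp
        moreover have "bounded (U i \<inter> S)" for i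
          using bdd by auto
        ultimately show ?thesis
          using fine_coversD(1)[OF U] that(1) unfolding fine_covers_def by blast
      qed
      have split: "ennreal (diameter (U i \<inter> A)) + ennreal (diameter (U i \<inter> B)) \<le> ennreal (diameter (U i))"
        for i
      proof -
        have "U i \<inter> A = {} \<or> U i \<inter> B = {}"
        proof (rule ccontr)
          assume "\<not> ?thesis"
          then obtain x y where xy: "x \<in> U i" "x \<in> A" "y \<in> U i" "y \<in> B" by auto
          then have "dist x y \<le> diameter (U i)"
            using bdd by (intro diameter_bounded_bound) auto
          then show False
            using sep[OF xy(2,4)] fine_coversD(3)[OF U, of i] \<eta>(2) by linarith
        qed
        moreover have "diameter (U i \<inter> S) \<le> diameter (U i)" for S
          using bdd by (intro diameter_subset) auto
        ultimately show ?thesis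
          by (auto intro!: ennreal_leI simp del: Int_iff)
      qed
      have "hausdorff1_scale \<delta> A + hausdorff1_scale \<epsilon> B
          \<le> (\<Sum>i. ennreal (diameter (U i \<inter> A))) + (\<Sum>i. ennreal (diameter (U i \<inter> B)))"
        using \<eta> by (intro add_mono hausdorff1_scale_le restrict) auto
      also have "\<dots> = (\<Sum>i. ennreal (diameter (U i \<inter> A)) + ennreal (diameter (U i \<inter> B)))"
        by (intro suminf_add) auto
      also have "\<dots> \<le> (\<Sum>i. ennreal (diameter (U i)))"
        by (intro suminf_le split) auto
      finally show ?thesis .
    qed
    then have "hausdorff1_scale \<delta> A + hausdorff1_scale \<epsilon> B \<le> hausdorff1_scale \<eta> (A \<union> B)"
      unfolding hausdorff1_scale_def[of \<eta>] by (rule INF_greatest)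
    also have "\<dots> \<le> hausdorff1 (A \<union> B)"
      using \<eta> by (intro hausdorff1_scale_le_hausdorff1)
    finally show ?thesis .
  qed
  have "hausdorff1 A + hausdorff1 B
      = (SUP \<delta>\<in>{0<..}. SUP \<epsilon>\<in>{0<..}. hausdorff1_scale \<delta> A + hausdorff1_scale \<epsilon> B)"
    unfolding hausdorff1_eq
    by (subst ennreal_SUP_add_left[symmetric], simp, subst ennreal_SUP_add_right, simp) simp
  also have "\<dots> \<le> hausdorff1 (A \<union> B)"
    using scale by (intro SUP_least) auto
  finally show ?thesis .
qed

lemma hausdorff1_UN_disjoint_compact_ge:
  fixes K :: "'i \<Rightarrow> 'a::heine_borel set"
  assumes "finite I" "\<And>i. i \<in> I \<Longrightarrow> compact (K i)" "disjoint_family_on K I"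
  shows "(\<Sum>i\<in>I. hausdorff1 (K i)) \<le> hausdorff1 (\<Union>i\<in>I. K i)"
  using assms
proof (induction I)
  case (insert i I)
  have "compact (\<Union>j\<in>I. K j)"
    using insert by (intro compact_UN) auto
  moreover have "K i \<inter> (\<Union>j\<in>I. K j) = {}"
    using insert.prems(2) insert.hyps(2) by (auto simp: disjoint_family_on_def)
  ultimately obtain d where "d > 0" "\<And>x y. x \<in> K i \<Longrightarrow> y \<in> (\<Union>j\<in>I. K j) \<Longrightarrow> d \<le> dist x y"
    using separate_compact_closed[OF insert.prems(1)[OF insertI1] compact_imp_closed] by meson
  then have "hausdorff1 (K i) + hausdorff1 (\<Union>j\<in>I. K j) \<le> hausdorff1 (K i \<union> (\<Union>j\<in>I. K j))"
    by (rule hausdorff1_Un_separated_ge)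
  moreover have "(\<Sum>j\<in>I. hausdorff1 (K j)) \<le> hausdorff1 (\<Union>j\<in>I. K j)"
    using insert.prems by (intro insert.IH) (auto simp: disjoint_family_on_def)
  ultimately show ?case
    using insert.hyps by simp (meson add_left_mono order_trans)
qed simp

text \<open>
  Arcs that overlap only at their endpoints are not separated. Cutting off a parameter interval of
  length \<open>\<eta>\<close> at both ends makes them disjoint compact sets, at a total cost of \<open>2 \<eta>\<close> per arc.
\<close>

lemma hausdorff1_UN_arcs_ge:
  fixes \<gamma> :: "'i \<Rightarrow> real \<Rightarrow> 'a::heine_borel"
  assumes "finite I"
    and cont: "\<And>i. i \<in> I \<Longrightarrow> continuous_on {0..L i} (\<gamma> i)"
    and len: "\<And>i s t. i \<in> I \<Longrightarrow> 0 \<le> s \<Longrightarrow> t \<le> L i \<Longrightarrow> ennreal (t - s) \<le> hausdorff1 (\<gamma> i ` {s..t})"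
    and disj: "disjoint_family_on (\<lambda>i. \<gamma> i ` {0<..<L i}) I"
  shows "ennreal (\<Sum>i\<in>I. L i) \<le> hausdorff1 (\<Union>i\<in>I. \<gamma> i ` {0..L i})"
proof (rule ennreal_le_epsilon)
  fix e :: real assume "e > 0"
  define \<eta> where "\<eta> = e / (2 * (card I + 1))"
  have "\<eta> > 0" using \<open>e > 0\<close> by (simp add: \<eta>_def)
  have "card I * (2 * \<eta>) = e * (card I / (card I + 1))"
    by (simp add: \<eta>_def field_simps)
  also have "\<dots> \<le> e * 1"
    using \<open>e > 0\<close> by (intro mult_left_mono) auto
  finally have \<eta>_e: "card I * (2 * \<eta>) \<le> e" by simp
  define K where "K i = \<gamma> i ` {\<eta>..L i - \<eta>}" for i
  \<comment> \<open>The maximum covers arcs shorter than \<open>2 * \<eta>\<close>, of which nothing remains.\<close>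
  have "ennreal (\<Sum>i\<in>I. L i) \<le> ennreal ((\<Sum>i\<in>I. max 0 (L i - 2 * \<eta>)) + e)"
  proof (rule ennreal_leI)
    have "(\<Sum>i\<in>I. L i) \<le> (\<Sum>i\<in>I. max 0 (L i - 2 * \<eta>) + 2 * \<eta>)"
      by (intro sum_mono) auto
    then show "(\<Sum>i\<in>I. L i) \<le> (\<Sum>i\<in>I. max 0 (L i - 2 * \<eta>)) + e"
      using \<eta>_e by (simp add: sum.distrib)
  qed
  also have "\<dots> = (\<Sum>i\<in>I. ennreal (max 0 (L i - 2 * \<eta>))) + ennreal e"
    using \<open>e > 0\<close> by (subst ennreal_plus) (auto intro!: sum_nonneg simp: sum_ennreal)
  also have "(\<Sum>i\<in>I. ennreal (max 0 (L i - 2 * \<eta>))) \<le> (\<Sum>i\<in>I. hausdorff1 (K i))"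
  proof (rule sum_mono)
    fix i assume "i \<in> I"
    then have "ennreal ((L i - \<eta>) - \<eta>) \<le> hausdorff1 (K i)"
      unfolding K_def using \<open>\<eta> > 0\<close> by (intro len) auto
    then show "ennreal (max 0 (L i - 2 * \<eta>)) \<le> hausdorff1 (K i)"
      by (simp add: max_def)
  qed
  also have "(\<Sum>i\<in>I. hausdorff1 (K i)) \<le> hausdorff1 (\<Union>i\<in>I. K i)"
  proof (rule hausdorff1_UN_disjoint_compact_ge[OF \<open>finite I\<close>])
    show "compact (K i)" if "i \<in> I" for i
      unfolding K_def using that \<open>\<eta> > 0\<close>
      by (intro compact_continuous_image continuous_on_subset[OF cont]) auto
    have sub: "K i \<subseteq> \<gamma> i ` {0<..<L i}" for i
      using \<open>\<eta> > 0\<close> by (auto simp: K_def)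
    show "disjoint_family_on K I"
      unfolding disjoint_family_on_def
    proof (intro ballI impI)
      fix i j assume "i \<in> I" "j \<in> I" "i \<noteq> j"
      then have "\<gamma> i ` {0<..<L i} \<inter> \<gamma> j ` {0<..<L j} = {}"
        using disj by (simp add: disjoint_family_on_def)
      then show "K i \<inter> K j = {}"
        using sub[of i] sub[of j] by blast
    qed
  qed
  also have "\<dots> \<le> hausdorff1 (\<Union>i\<in>I. \<gamma> i ` {0..L i})"
    using \<open>\<eta> > 0\<close> by (intro hausdorff1_mono) (force simp: K_def)
  finally show "ennreal (\<Sum>i\<in>I. L i) \<le> hausdorff1 (\<Union>i\<in>I. \<gamma> i ` {0..L i}) + ennreal e"
    by (simp add: add_right_mono)
qed

lemma hausdorff1_UN_arcs_eq:
  fixes \<gamma> :: "'i \<Rightarrow> real \<Rightarrow> 'a::heine_borel"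
  assumes "finite I" "\<And>i. i \<in> I \<Longrightarrow> 0 \<le> L i"
    and cont: "\<And>i. i \<in> I \<Longrightarrow> continuous_on {0..L i} (\<gamma> i)"
    and len: "\<And>i s t. i \<in> I \<Longrightarrow> 0 \<le> s \<Longrightarrow> s \<le> t \<Longrightarrow> t \<le> L i \<Longrightarrow> hausdorff1 (\<gamma> i ` {s..t}) = ennreal (t - s)"
    and disj: "disjoint_family_on (\<lambda>i. \<gamma> i ` {0<..<L i}) I"
  shows "hausdorff1 (\<Union>i\<in>I. \<gamma> i ` {0..L i}) = ennreal (\<Sum>i\<in>I. L i)"
proof (rule antisym)
  have "hausdorff1 (\<Union>i\<in>I. \<gamma> i ` {0..L i}) \<le> (\<Sum>i\<in>I. hausdorff1 (\<gamma> i ` {0..L i}))"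
    by (rule hausdorff1_UN_le[OF \<open>finite I\<close>])
  also have "\<dots> = (\<Sum>i\<in>I. ennreal (L i))"
    using len[of _ 0 "L _"] assms(2) by (intro sum.cong) auto
  finally show "hausdorff1 (\<Union>i\<in>I. \<gamma> i ` {0..L i}) \<le> ennreal (\<Sum>i\<in>I. L i)"
    using assms(2) by (simp add: sum_ennreal)
  show "ennreal (\<Sum>i\<in>I. L i) \<le> hausdorff1 (\<Union>i\<in>I. \<gamma> i ` {0..L i})"
  proof (rule hausdorff1_UN_arcs_ge[OF \<open>finite I\<close> cont _ disj])
    fix i and s t :: real assume "i \<in> I" "0 \<le> s" "t \<le> L i"
    then show "ennreal (t - s) \<le> hausdorff1 (\<gamma> i ` {s..t})"
      using len[of i s t] by (cases "s \<le> t") (auto simp: ennreal_neg)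
  qed
qed

section \<open>Lengths of segments, triangles and circular arcs\<close>

lemma hausdorff1_segment:
  fixes a e :: "'a::real_normed_vector"
  assumes "norm e = 1" "s \<le> t"
  shows "hausdorff1 ((\<lambda>r. a + r *\<^sub>R e) ` {s..t}) = ennreal (t - s)"
proof (rule antisym)
  let ?S = "(\<lambda>r. a + r *\<^sub>R e) ` {s..t}"
  have isometry: "dist (a + x *\<^sub>R e) (a + y *\<^sub>R e) = dist x y" for x y
    using assms by (simp add: dist_norm flip: scaleR_diff_left)
  then have "hausdorff1 ?S \<le> ennreal 1 * hausdorff1 {s..t}"
    by (intro hausdorff1_lipschitz_image[of 1]) auto
  also have "\<dots> \<le> ennreal (t - s)"
    using hausdorff1_interval_le[OF \<open>s \<le> t\<close>] by simp
  finally show "hausdorff1 ?S \<le> ennreal (t - s)" .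
  have "hausdorff1 {s..t} \<le> ennreal 1 * hausdorff1 ?S"
    using isometry by (intro hausdorff1_le_expanding_image[of 1]) auto
  then show "ennreal (t - s) \<le> hausdorff1 ?S"
    by (intro order_trans[OF hausdorff1_interval_ge]) simp
qed

lemma closed_segment_eq_unit_speed:
  fixes p q :: "'a::real_normed_vector"
  assumes "p \<noteq> q"
  shows "(\<lambda>r. p + r *\<^sub>R sgn (q - p)) ` {0..dist p q} = closed_segment p q"
    and "(\<lambda>r. p + r *\<^sub>R sgn (q - p)) ` {0<..<dist p q} = open_segment p q"
proof -
  have rescale: "(\<lambda>r. p + r *\<^sub>R sgn (q - p)) = (\<lambda>u. (1 - u) *\<^sub>R p + u *\<^sub>R q) \<circ> (\<lambda>r. r / dist p q)"
    by (auto simp: fun_eq_iff sgn_div_norm dist_norm norm_minus_commute algebra_simps divide_inverse)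
  have "(\<lambda>r. r / dist p q) ` {0..dist p q} = {0..1}"
    using image_divide_atLeastAtMost[of "dist p q" 0 "dist p q"] assms by simp
  then show "(\<lambda>r. p + r *\<^sub>R sgn (q - p)) ` {0..dist p q} = closed_segment p q"
    unfolding rescale image_comp[symmetric] closed_segment_image_interval by simp
  have "(\<lambda>r. r / dist p q) ` {0<..<dist p q} = {0<..<1}"
  proof (intro equalityI subsetI)
    fix u :: real assume "u \<in> {0<..<1}"
    then have "u * dist p q \<in> {0<..<dist p q}" "u = u * dist p q / dist p q"
      using assms by auto
    then show "u \<in> (\<lambda>r. r / dist p q) ` {0<..<dist p q}" by blast
  qed (use assms in auto)
  then show "(\<lambda>r. p + r *\<^sub>R sgn (q - p)) ` {0<..<dist p q} = open_segment p q"
    unfolding rescale image_comp[symmetric] open_segment_image_interval using assms by simp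
qed

text \<open>
  Two open sides with a common point would put the three vertices on one line.
\<close>

lemma hausdorff1_triangle:
  fixes a b c :: "'a::euclidean_space"
  assumes "\<not> collinear {a, b, c}"
  shows "hausdorff1 (closed_segment a b \<union> closed_segment b c \<union> closed_segment c a)
    = ennreal (dist a b + dist b c + dist c a)"
proof -
  define I where "I = {(a,b), (b,c), (c,a)}"
  define L where "L = (\<lambda>(p::'a,q). dist p q)"
  define \<gamma> where "\<gamma> = (\<lambda>(p::'a,q) r. p + r *\<^sub>R sgn (q - p))"
  have neq: "a \<noteq> b" "b \<noteq> c" "c \<noteq> a"
    using assms collinear_2 by (auto simp: insert_commute)
  have neqI: "fst i \<noteq> snd i" if "i \<in> I" for i
    using that neq by (auto simp: I_def)
  have disj: "open_segment p q \<inter> open_segment q r = {}" if "\<not> collinear {p, q, r}" for p q r :: 'a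
  proof -
    have False if "x \<in> open_segment p q" "x \<in> open_segment q r" for x
    proof -
      have "x \<noteq> q" "collinear {p, x, q}" "collinear {q, x, r}"
        using that by (auto simp: open_segment_def between_imp_collinear between_mem_segment)
      then have "collinear {p, q, r}"
        using collinear_3_trans[of p q x r] by (simp add: insert_commute)
      then show False using \<open>\<not> collinear {p, q, r}\<close> by simp
    qed
    then show ?thesis by auto
  qed
  have "open_segment a b \<inter> open_segment b c = {}" "open_segment b c \<inter> open_segment c a = {}"
       "open_segment c a \<inter> open_segment a b = {}"
    using disj[of a b c] disj[of b c a] disj[of c a b] assms by (simp_all add: insert_commute)
  then have "disjoint_family_on (\<lambda>(p, q). open_segment p q) I"
    by (auto simp: disjoint_family_on_def I_def)
  moreover have "\<gamma> i ` {0<..<L i} = (case i of (p, q) \<Rightarrow> open_segment p q)" if "i \<in> I" for i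
    using closed_segment_eq_unit_speed(2)[OF neqI[OF that]] by (simp add: \<gamma>_def L_def split_beta)
  ultimately have "disjoint_family_on (\<lambda>i. \<gamma> i ` {0<..<L i}) I"
    by (simp add: disjoint_family_on_def)
  moreover have "continuous_on {0..L i} (\<gamma> i)" for i
    by (auto simp: \<gamma>_def split_beta intro!: continuous_intros)
  moreover have "hausdorff1 (\<gamma> i ` {s..t}) = ennreal (t - s)" if "i \<in> I" "s \<le> t" for i s t
    unfolding \<gamma>_def split_beta using neqI[OF that(1)] that(2)
    by (intro hausdorff1_segment) (simp_all add: norm_sgn)
  ultimately have "hausdorff1 (\<Union>i\<in>I. \<gamma> i ` {0..L i}) = ennreal (\<Sum>i\<in>I. L i)"
    by (intro hausdorff1_UN_arcs_eq) (auto simp: I_def L_def)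
  also have "(\<Sum>i\<in>I. L i) = dist a b + dist b c + dist c a"
    using neq by (simp add: I_def L_def)
  also have "(\<Union>i\<in>I. \<gamma> i ` {0..L i}) = closed_segment a b \<union> closed_segment b c \<union> closed_segment c a"
    using neq by (simp add: I_def L_def \<gamma>_def closed_segment_eq_unit_speed Un_assoc)
  finally show ?thesis .
qed

text \<open>
  With \<open>a, b \<in> {1, -1}\<close> this is a unit speed parametrization of the unit circle whose restriction to
  \<open>{0..pi / 2}\<close> traces the quadrant with signs \<open>a\<close> and \<open>b\<close>.
\<close>

definition ellipse_pt :: "real \<Rightarrow> real \<Rightarrow> real \<Rightarrow> real^2" where
  "ellipse_pt a b t = vector [a * cos t, b * sin t]"

lemma ellipse_pt_nth [simp]:
  "ellipse_pt a b t $ 1 = a * cos t" "ellipse_pt a b t $ 2 = b * sin t"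
  by (simp_all add: ellipse_pt_def)

lemma norm_plane: "(norm (x :: real^2))\<^sup>2 = (x $ 1)\<^sup>2 + (x $ 2)\<^sup>2"
  unfolding power2_norm_eq_inner by (simp add: inner_vec_def sum_2 power2_eq_square)

lemma dist_ellipse_pt:
  assumes "a\<^sup>2 = 1" "b\<^sup>2 = 1"
  shows "dist (ellipse_pt a b s) (ellipse_pt a b t) = 2 * \<bar>sin ((s - t) / 2)\<bar>"
proof -
  have "(dist (ellipse_pt a b s) (ellipse_pt a b t))\<^sup>2
      = (a * (cos s - cos t))\<^sup>2 + (b * (sin s - sin t))\<^sup>2"
    by (simp add: dist_norm norm_plane right_diff_distrib)
  also have "\<dots> = (cos s - cos t)\<^sup>2 + (sin s - sin t)\<^sup>2"
    using assms by (simp add: power_mult_distrib)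
  also have "\<dots> = (sin s ^ 2 + cos s ^ 2) + (sin t ^ 2 + cos t ^ 2) - 2 * (cos s * cos t + sin s * sin t)"
    by (simp add: power2_eq_square algebra_simps)
  also have "\<dots> = 2 - 2 * cos (s - t)"
    by (simp add: cos_diff)
  also have "\<dots> = 2 - 2 * cos (2 * ((s - t) / 2))"
    by (simp only: field_sum_of_halves mult_2)
  also have "\<dots> = (2 * \<bar>sin ((s - t) / 2)\<bar>)\<^sup>2"
    unfolding cos_double_sin by (simp add: power_mult_distrib)
  finally show ?thesis
    by (rule power2_eq_imp_eq) simp_all
qed

lemma hausdorff1_circle_arc_le:
  assumes "a\<^sup>2 = 1" "b\<^sup>2 = 1" "s \<le> t"
  shows "hausdorff1 (ellipse_pt a b ` {s..t}) \<le> ennreal (t - s)"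
proof -
  have "hausdorff1 (ellipse_pt a b ` {s..t}) \<le> ennreal 1 * hausdorff1 {s..t}"
  proof (rule hausdorff1_lipschitz_image[of 1])
    fix x y :: real
    show "dist (ellipse_pt a b x) (ellipse_pt a b y) \<le> 1 * dist x y"
      using abs_sin_x_le_abs_x[of "(x - y) / 2"] by (simp add: dist_ellipse_pt assms dist_real_def)
  qed auto
  also have "\<dots> \<le> ennreal (t - s)"
    using hausdorff1_interval_le[OF \<open>s \<le> t\<close>] by simp
  finally show ?thesis .
qed

text \<open>
  This compares an arc of the unit circle with its chord. The smallness condition is on \<open>sin y\<close>
  because it is the chord that a fine cover controls.
\<close>

lemma sin_ge_near_0:
  fixes C :: real
  assumes "C > 1"
  obtains \<epsilon> where "\<epsilon> > 0" "\<And>y. 0 \<le> y \<Longrightarrow> y \<le> pi / 2 \<Longrightarrow> sin y \<le> \<epsilon> \<Longrightarrow> y \<le> C * sin y"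
proof -
  have "((\<lambda>y. sin y / y) \<longlongrightarrow> 1) (at (0::real))"
    using DERIV_sin[of 0] by (simp add: has_field_derivative_def DERIV_def flip: has_field_derivative_def)
  then have "eventually (\<lambda>y::real. 1 / C < sin y / y) (at 0)"
    using assms by (intro order_tendstoD(1)[of _ 1]) auto
  then obtain d where "d > 0" and d: "\<And>y::real. y \<noteq> 0 \<Longrightarrow> dist y 0 < d \<Longrightarrow> 1 / C < sin y / y"
    unfolding eventually_at by blast
  \<comment> \<open>On \<open>{0..pi / 2}\<close> the sine is increasing, so \<open>sin y \<le> sin z\<close> forces \<open>y \<le> z\<close>, where the
    derivative at 0 gives the bound.\<close>
  define z where "z = min (d / 2) (pi / 2)"
  have z: "0 < z" "z < d" "z \<le> pi / 2"
    using \<open>d > 0\<close> by (auto simp: z_def)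
  have "y \<le> C * sin y" if y: "0 \<le> y" "y \<le> pi / 2" "sin y \<le> sin z" for y
  proof (cases "y = 0")
    case False
    have "y \<le> z"
      using y z sin_mono_le_eq[of y z] by simp
    then have "1 / C < sin y / y"
      using d[of y] y False z by simp
    then show ?thesis
      using y False assms by (simp add: field_simps)
  qed simp
  moreover have "sin z > 0"
    using z pi_gt_zero by (intro sin_gt_zero) linarith+
  ultimately show ?thesis using that by blast
qed

text \<open>
  Chords are shorter than arcs, which gives the upper bound. Conversely, short chords are at least
  \<open>1 / C\<close> times their arcs for any given \<open>C > 1\<close>. Beyond the length \<open>pi\<close> chords become short again,
  so that a short chord would no longer mean a short arc.
\<close>

lemma hausdorff1_circle_arc:
  assumes "a\<^sup>2 = 1" "b\<^sup>2 = 1" "s \<le> t" "t - s \<le> pi"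
  shows "hausdorff1 (ellipse_pt a b ` {s..t}) = ennreal (t - s)"
proof (rule antisym)
  have scaled: "ennreal (t - s) \<le> ennreal C * hausdorff1 (ellipse_pt a b ` {s..t})" if "C > 1" for C
  proof -
    obtain \<epsilon> where \<epsilon>: "\<epsilon> > 0" "\<And>y. 0 \<le> y \<Longrightarrow> y \<le> pi / 2 \<Longrightarrow> sin y \<le> \<epsilon> \<Longrightarrow> y \<le> C * sin y"
      using sin_ge_near_0[OF \<open>C > 1\<close>] by metis
    have "hausdorff1 {s..t} \<le> ennreal C * hausdorff1 (ellipse_pt a b ` {s..t})"
    proof (rule hausdorff1_le_expanding_image[of \<epsilon>])
      fix x y assume xy: "x \<in> {s..t}" "y \<in> {s..t}" "dist (ellipse_pt a b x) (ellipse_pt a b y) \<le> \<epsilon>"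
      define u where "u = \<bar>x - y\<bar> / 2"
      have u: "0 \<le> u" "u \<le> pi / 2"
        using xy(1,2) assms(4) by (auto simp: u_def)
      then have "sin u \<ge> 0"
        using pi_ge_zero by (intro sin_ge_zero) linarith+
      moreover have "(x - y) / 2 = u \<or> (x - y) / 2 = - u"
        by (auto simp: u_def abs_if)
      ultimately have "\<bar>sin ((x - y) / 2)\<bar> = sin u"
        by (elim disjE) simp_all
      then have "dist (ellipse_pt a b x) (ellipse_pt a b y) = 2 * sin u"
        by (simp add: dist_ellipse_pt assms)
      moreover have "u \<le> C * sin u"
        using \<epsilon>(2)[OF u] xy(3) calculation \<open>sin u \<ge> 0\<close> by linarith
      ultimately show "dist x y \<le> C * dist (ellipse_pt a b x) (ellipse_pt a b y)"
        by (simp add: u_def dist_real_def)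
    qed (use \<epsilon> \<open>C > 1\<close> in auto)
    with hausdorff1_interval_ge show ?thesis by (rule order_trans)
  qed
  show "ennreal (t - s) \<le> hausdorff1 (ellipse_pt a b ` {s..t})"
  proof (cases "hausdorff1 (ellipse_pt a b ` {s..t})")
    case (real r)
    have "t - s \<le> r + e" if "e > 0" for e
    proof -
      \<comment> \<open>The denominator is \<open>r + 1\<close> since \<open>r\<close> might be 0.\<close>
      have "ennreal (t - s) \<le> ennreal ((1 + e / (r + 1)) * r)"
        using scaled[of "1 + e / (r + 1)"] that real by (simp add: ennreal_mult)
      then have "t - s \<le> (1 + e / (r + 1)) * r"
        using that real by (subst (asm) ennreal_le_iff) auto
      also have "\<dots> = r + e * (r / (r + 1))"
        by (simp add: algebra_simps)
      also have "\<dots> \<le> r + e * 1"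
        using that real by (intro add_left_mono mult_left_mono) auto
      finally show ?thesis by simp
    qed
    then have "t - s \<le> r" by (rule field_le_epsilon)
    then show ?thesis using real by (simp add: ennreal_leI)
  qed simp
qed (rule hausdorff1_circle_arc_le[OF assms(1-3)])

lemma hausdorff1_unit_circle_le: "hausdorff1 (sphere 0 1 :: (real^2) set) \<le> ennreal (2 * pi)"
proof -
  have "sphere 0 1 \<subseteq> ellipse_pt 1 1 ` {0..2 * pi}"
  proof
    fix u :: "real^2" assume "u \<in> sphere 0 1"
    then have "(u $ 1)\<^sup>2 + (u $ 2)\<^sup>2 = 1"
      using norm_plane[of u] by simp
    then obtain t where "0 \<le> t" "t < 2 * pi" "u $ 1 = cos t" "u $ 2 = sin t"
      using sincos_total_2pi by metis
    then have "u = ellipse_pt 1 1 t" "t \<in> {0..2 * pi}"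
      by (auto simp: vec_eq_iff forall_2)
    then show "u \<in> ellipse_pt 1 1 ` {0..2 * pi}" by blast
  qed
  then have "hausdorff1 (sphere 0 1 :: (real^2) set) \<le> hausdorff1 (ellipse_pt 1 1 ` {0..2 * pi})"
    by (rule hausdorff1_mono)
  also have "\<dots> \<le> ennreal (2 * pi)"
    using hausdorff1_circle_arc_le[of 1 1 0 "2 * pi"] by simp
  finally show ?thesis .
qed

section \<open>Monotonicity of the perimeter\<close>

text \<open>
  If \<open>T\<close> has no interior it lies in a hyperplane, and a normal of that hyperplane serves even at points
  of the relative interior.
\<close>

lemma frontier_outer_normal:
  fixes T :: "'a::euclidean_space set"
  assumes "convex T" "closed T" "y \<in> frontier T"
  shows "\<exists>u. u \<noteq> 0 \<and> (\<forall>z\<in>T. u \<bullet> z \<le> u \<bullet> y)"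
proof -
  have "y \<in> T" using assms frontier_subset_closed by blast
  show ?thesis
  proof (cases "y \<in> rel_interior T")
    case True
    have "interior T = {}"
      using assms(3) True interior_rel_interior_gen[of T] by (auto simp: frontier_def split: if_splits)
    then obtain a b where "a \<noteq> 0" and sub: "T \<subseteq> {x. a \<bullet> x = b}"
      using empty_interior_subset_hyperplane[OF \<open>convex T\<close>] by metis
    have "\<forall>z\<in>T. a \<bullet> z \<le> a \<bullet> y"
      using subsetD[OF sub] \<open>y \<in> T\<close> by auto
    then show ?thesis using \<open>a \<noteq> 0\<close> by blast
  next
    case False
    then obtain a where a: "a \<noteq> 0" "\<And>z. z \<in> closure T \<Longrightarrow> a \<bullet> y \<le> a \<bullet> z"
      using supporting_hyperplane_relative_frontier[OF \<open>convex T\<close>, of y] \<open>y \<in> T\<close> closure_subset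
      by (metis subsetD)
    then have "- a \<noteq> 0 \<and> (\<forall>z\<in>T. (- a) \<bullet> z \<le> (- a) \<bullet> y)"
      using a(2) closure_subset[of T] by auto
    then show ?thesis by blast
  qed
qed

text \<open>
  Perimeter is monotone under inclusion when the inner set is convex. The nearest point projection onto
  \<open>T\<close> does not increase distances, and it maps \<open>frontier E\<close> onto a superset of \<open>frontier T\<close>: from
  \<open>y \<in> frontier T\<close> one follows an outer normal until it leaves \<open>E\<close>, and every point of this ray
  projects to \<open>y\<close>.
\<close>

lemma hausdorff1_frontier_mono:
  fixes T E :: "'a::euclidean_space set"
  assumes "bounded E" "convex T" "closed T" "T \<subseteq> closure E"
  shows "hausdorff1 (frontier T) \<le> hausdorff1 (frontier E)"
proof (cases "T = {}")
  case False
  have "frontier T \<subseteq> closest_point T ` frontier E"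
  proof
    fix y assume y: "y \<in> frontier T"
    then have "y \<in> T" "y \<in> closure E"
      using assms frontier_subset_closed by blast+
    obtain u where "u \<noteq> 0" and u: "\<And>z. z \<in> T \<Longrightarrow> u \<bullet> z \<le> u \<bullet> y"
      using frontier_outer_normal[OF assms(2,3) y] by metis
    obtain B where "B > 0" and B: "\<And>x. x \<in> closure E \<Longrightarrow> norm x < B"
      using bounded_closure[OF \<open>bounded E\<close>] unfolding bounded_pos_less by metis
    \<comment> \<open>This length guarantees that \<open>y + r *\<^sub>R u\<close> has norm at least \<open>B\<close>.\<close>
    define r where "r = (B + norm y) / norm u"
    have "r \<ge> 0"
      using \<open>0 < B\<close> by (simp add: r_def)
    have "norm (r *\<^sub>R u) \<le> norm (y + r *\<^sub>R u) + norm y"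
      by (metis add_diff_cancel_left' norm_triangle_ineq4)
    moreover have "norm (r *\<^sub>R u) = B + norm y"
      using \<open>u \<noteq> 0\<close> \<open>0 < B\<close> by (simp add: r_def)
    ultimately have "y + r *\<^sub>R u \<notin> closure E"
      using B[of "y + r *\<^sub>R u"] by linarith
    then have "closed_segment y (y + r *\<^sub>R u) \<inter> frontier (closure E) \<noteq> {}"
      using \<open>y \<in> closure E\<close> by (intro connected_Int_frontier) auto
    then obtain x where x: "x \<in> closed_segment y (y + r *\<^sub>R u)" "x \<in> frontier (closure E)"
      by blast
    then have "x \<in> frontier E"
      using interior_mono[OF closure_subset[of E]] by (auto simp: frontier_def)
    obtain v where "v \<ge> 0" "x = (1 - v) *\<^sub>R y + v *\<^sub>R (y + r *\<^sub>R u)"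
      using x(1) by (auto simp: in_segment)
    then obtain w where w: "w \<ge> 0" "x = y + w *\<^sub>R u"
      using \<open>r \<ge> 0\<close> by (intro that[of "v * r"]) (auto simp: algebra_simps)
    have "y = closest_point T x"
    proof (rule closest_point_unique[OF assms(2,3) \<open>y \<in> T\<close>], rule ballI)
      fix z assume "z \<in> T"
      have "(norm (x - y))\<^sup>2 \<le> (norm (x - z))\<^sup>2"
      proof -
        have "(norm (p + q))\<^sup>2 = (norm p)\<^sup>2 + 2 * (p \<bullet> q) + (norm q)\<^sup>2" for p q :: 'a
          unfolding power2_norm_eq_inner
          by (simp add: inner_add_left inner_add_right inner_commute[of q p])
        from this[of "x - y" "y - z"]
        have "(norm (x - z))\<^sup>2 = (norm (x - y))\<^sup>2 + 2 * ((x - y) \<bullet> (y - z)) + (norm (y - z))\<^sup>2"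
          by simp
        moreover have "(x - y) \<bullet> (y - z) \<ge> 0"
          using w u[OF \<open>z \<in> T\<close>] by (simp add: inner_diff_right mult_left_mono)
        ultimately show ?thesis by simp
      qed
      then show "dist x y \<le> dist x z"
        by (simp add: dist_norm)
    qed
    then show "y \<in> closest_point T ` frontier E"
      using \<open>x \<in> frontier E\<close> by blast
  qed
  then have "hausdorff1 (frontier T) \<le> hausdorff1 (closest_point T ` frontier E)"
    by (rule hausdorff1_mono)
  also have "\<dots> \<le> ennreal 1 * hausdorff1 (frontier E)"
    using closest_point_lipschitz[OF assms(2,3) False]
    by (intro hausdorff1_lipschitz_image[of 1]) auto
  finally show ?thesis by simp
qed simp

lemma triangle_le_perimeter:
  fixes E :: "(real^2) set"
  assumes "bounded E" "convex E" "{a, b, c} \<subseteq> closure E" "\<not> collinear {a, b, c}"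
  shows "ennreal (dist a b + dist b c + dist c a) \<le> perimeter E"
proof -
  have "ennreal (dist a b + dist b c + dist c a) \<le> hausdorff1 (frontier (convex hull {a, b, c}))"
    using hausdorff1_triangle[OF assms(4)] by (simp add: frontier_of_triangle)
  also have "\<dots> \<le> perimeter E"
    unfolding perimeter_def
  proof (rule hausdorff1_frontier_mono[OF \<open>bounded E\<close>])
    show "convex hull {a, b, c} \<subseteq> closure E"
      using assms by (intro hull_minimal convex_closure)
    show "closed (convex hull {a, b, c})"
      by (intro compact_imp_closed finite_imp_compact_convex_hull) simp
  qed simp
  finally show ?thesis .
qed

section \<open>Enclosing discs of radius less than a quarter of the perimeter\<close>

lemma not_collinear_strict_triangle:
  fixes a b c :: "'a::euclidean_space"
  assumes "\<not> collinear {a, b, c}"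
  shows "dist a b < dist a c + dist c b"
  using assms between[of a b c] between_imp_collinear[of a b c] dist_triangle[of a b c]
  by (auto simp: insert_commute less_le)

text \<open>
  The centre is the midpoint of a chord \<open>aq\<close> that halves the perimeter, with \<open>q\<close> on the side \<open>bc\<close>:
  both \<open>b\<close> and \<open>c\<close> then have distances to \<open>a\<close> and \<open>q\<close> that add up to \<open>P / 2\<close>.
\<close>

lemma triangle_in_quarter_perimeter_ball:
  fixes a b c :: "'a::euclidean_space"
  assumes "\<not> collinear {a, b, c}"
  defines "P \<equiv> dist a b + dist b c + dist c a"
  shows "\<exists>m. \<forall>x\<in>{a, b, c}. dist m x < P / 4"
proof -
  have neq: "a \<noteq> b" "b \<noteq> c" "c \<noteq> a"
    using assms collinear_2 by (auto simp: insert_commute)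
  have strict: "dist a b < dist b c + dist c a" "dist c a < dist a b + dist b c"
    using not_collinear_strict_triangle[of a b c] not_collinear_strict_triangle[of c a b] assms(1)
    by (simp_all add: insert_commute dist_commute add.commute)
  \<comment> \<open>Starting at \<open>a\<close>, half of the perimeter is used up after the side \<open>ab\<close> and the fraction \<open>\<tau>\<close>
    of \<open>bc\<close>.\<close>
  define \<tau> where "\<tau> = (P / 2 - dist a b) / dist b c"
  have "0 < \<tau>" "\<tau> < 1"
    using strict neq by (auto simp: \<tau>_def P_def field_simps)
  define q where "q = b + \<tau> *\<^sub>R (c - b)"
  define m where "m = (1/2) *\<^sub>R (a + q)"
  have bq: "dist b q = P / 2 - dist a b"
  proof -
    have "dist b q = \<tau> * dist b c"
      using \<open>0 < \<tau>\<close> by (simp add: q_def dist_norm norm_minus_commute)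
    then show ?thesis using neq by (simp add: \<tau>_def)
  qed
  have cq: "dist c q = P / 2 - dist c a"
  proof -
    have "c - q = (1 - \<tau>) *\<^sub>R (c - b)" by (simp add: q_def algebra_simps)
    then have "dist c q = dist b c - \<tau> * dist b c"
      using \<open>\<tau> < 1\<close> by (simp add: dist_norm norm_minus_commute left_diff_distrib)
    also have "\<tau> * dist b c = P / 2 - dist a b"
      using neq by (simp add: \<tau>_def)
    finally show ?thesis by (simp add: P_def field_simps)
  qed
  have half: "dist m x = norm ((x - a) + (x - q)) / 2" for x
  proof -
    have "x - m = (1/2) *\<^sub>R ((x + x) - (a + q))"
      by (simp only: m_def scaleR_right_diff_distrib scaleR_half_double)
    also have "(x + x) - (a + q) = (x - a) + (x - q)" by simp
    finally show ?thesis by (simp add: dist_norm norm_minus_commute[of m])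
  qed
  have not_coll: "\<not> collinear {a, x, q}" if "x \<in> {b, c}" for x
  proof
    assume "collinear {a, x, q}"
    moreover have "collinear {b, q, c}"
      using \<open>0 < \<tau>\<close> \<open>\<tau> < 1\<close>
      by (intro between_imp_collinear betweenI[of \<tau>]) (auto simp: q_def algebra_simps)
    moreover have "q \<noteq> b" "q \<noteq> c"
      using bq cq strict by (auto simp: P_def)
    ultimately show False
      using that assms(1) collinear_3_trans[of a b q c] collinear_3_trans[of a c q b]
      by (auto simp: insert_commute)
  qed
  have side: "dist m x < P / 4" if "x \<in> {b, c}" for x
  proof -
    have "norm ((x - a) + (x - q)) < norm (x - a) + norm (x - q)"
    proof (rule ccontr)
      assume "\<not> ?thesis"
      then have "norm ((x - a) + (x - q)) = norm (x - a) + norm (x - q)"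
        using norm_triangle_ineq[of "x - a" "x - q"] by linarith
      then have "collinear {0, x - a, x - q}"
        by (rule norm_triangle_eq_imp_collinear)
      then have "collinear {a, x, q}"
        using collinear_3[of a x q] collinear_scaleR_iff[of "-1" "a - x" "-1" "q - x"] by simp
      then show False using not_coll[OF that] by simp
    qed
    then show ?thesis
      using that bq cq by (auto simp: half) (auto simp: dist_norm norm_minus_commute)
  qed
  moreover have "dist m a < P / 4"
  proof -
    have "dist a q < dist a b + dist b q"
      using not_coll[of b] not_collinear_strict_triangle[of a q b]
      by (simp add: insert_commute dist_commute)
    then show ?thesis using bq by (simp add: half) (simp add: dist_norm)
  qed
  ultimately show ?thesis by auto
qed

lemma ex_not_collinear:
  fixes a b :: "'a::euclidean_space"
  assumes "a \<noteq> b" "interior E \<noteq> {}" "DIM('a) \<ge> 2"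
  shows "\<exists>x\<in>E. \<not> collinear {a, b, x}"
proof (rule ccontr)
  assume "\<not> ?thesis"
  then have "E \<subseteq> affine hull {a, b}"
    using collinear_3_affine_hull[OF \<open>a \<noteq> b\<close>] by blast
  then have "interior E \<subseteq> interior (affine hull {a, b})"
    by (rule interior_mono)
  also have "\<dots> = {}"
    using assms by (intro empty_interior_affine_hull) (auto simp: card_insert_if)
  finally show False using assms(2) by simp
qed

text \<open>
  Going from \<open>a\<close> to \<open>b\<close> and back is strictly shorter than the triangle through a point of \<open>E\<close> off the
  line, which exists because \<open>E\<close> has interior points.
\<close>

lemma diameter_lt_half_perimeter:
  fixes E :: "(real^2) set"
  assumes "bounded E" "convex E" "interior E \<noteq> {}" "perimeter E = ennreal l" "l > 0"
    and "a \<in> closure E" "b \<in> closure E"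
  shows "2 * dist a b < l"
proof (cases "a = b")
  case False
  then obtain x where x: "x \<in> E" "\<not> collinear {a, b, x}"
    using ex_not_collinear[OF False \<open>interior E \<noteq> {}\<close>] by auto
  then have "ennreal (dist a b + dist b x + dist x a) \<le> ennreal l"
    using triangle_le_perimeter[of E a b x] assms closure_subset[of E] by auto
  then have "dist a b + dist b x + dist x a \<le> l"
    using \<open>l > 0\<close> by (subst (asm) ennreal_le_iff) auto
  then show ?thesis
    using not_collinear_strict_triangle[OF x(2)] by (simp add: dist_commute)
qed (use \<open>l > 0\<close> in simp)

lemma three_points_in_small_ball:
  fixes E :: "(real^2) set"
  assumes E: "bounded E" "convex E" "interior E \<noteq> {}" "perimeter E = ennreal l" "l > 0"
    and abc: "{a, b, c} \<subseteq> closure E"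
  shows "\<exists>m. \<forall>x\<in>{a, b, c}. dist m x < l / 4"
proof (cases "collinear {a, b, c}")
  case False
  have "ennreal (dist a b + dist b c + dist c a) \<le> ennreal l"
    using triangle_le_perimeter[OF E(1,2) abc False] E(4) by simp
  then have "(dist a b + dist b c + dist c a) / 4 \<le> l / 4"
    using \<open>l > 0\<close> by (subst (asm) ennreal_le_iff) auto
  then show ?thesis
    using triangle_in_quarter_perimeter_ball[OF False] by (meson less_le_trans)
next
  case True
  have ends: "\<exists>m. \<forall>x\<in>{p, q, r}. dist m x < l / 4"
    if "between (p, q) r" "p \<in> closure E" "q \<in> closure E" for p q r
  proof (intro exI ballI)
    fix x assume "x \<in> {p, q, r}"
    have "convex (cball (midpoint p q) (dist p q / 2))"
      by (rule convex_cball)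
    moreover have "{p, q} \<subseteq> cball (midpoint p q) (dist p q / 2)"
      by (simp add: dist_midpoint)
    ultimately have "closed_segment p q \<subseteq> cball (midpoint p q) (dist p q / 2)"
      by (simp add: closed_segment_subset)
    then have "dist (midpoint p q) x \<le> dist p q / 2"
      using \<open>x \<in> {p, q, r}\<close> that(1) by (auto simp: between_mem_segment)
    also have "\<dots> < l / 4"
      using diameter_lt_half_perimeter[OF E that(2,3)] by simp
    finally show "dist (midpoint p q) x < l / 4" .
  qed
  consider "between (b, c) a" | "between (c, a) b" | "between (a, b) c"
    using True collinear_between_cases[of a b c] by blast
  then show ?thesis
    using ends[of b c a] ends[of c a b] ends[of a b c] abc by cases (auto simp: insert_commute)
qed

text \<open>
  The triples contained in a given open ball form an open set, so finitely many balls of radius less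
  than \<open>R\<close> serve all triples of the compact set.
\<close>

lemma uniform_triple_radius:
  fixes K :: "'a::heine_borel set"
  assumes "compact K"
    and triples: "\<And>a b c. a \<in> K \<Longrightarrow> b \<in> K \<Longrightarrow> c \<in> K \<Longrightarrow> \<exists>m. \<forall>x\<in>{a, b, c}. dist m x < R"
  obtains \<rho> where "\<rho> < R" "\<And>a b c. a \<in> K \<Longrightarrow> b \<in> K \<Longrightarrow> c \<in> K \<Longrightarrow> \<exists>m. \<forall>x\<in>{a, b, c}. dist m x \<le> \<rho>"
proof -
  define W where "W = (\<lambda>(m::'a, \<rho>). ball m \<rho> \<times> ball m \<rho> \<times> ball m \<rho>)"
  have "K \<times> K \<times> K \<subseteq> (\<Union>i\<in>UNIV \<times> {..<R}. W i)"
  proof clarify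
    fix a b c assume "a \<in> K" "b \<in> K" "c \<in> K"
    then obtain m where m: "dist m a < R" "dist m b < R" "dist m c < R"
      using triples[of a b c] by auto
    obtain \<rho> where "max (dist m a) (max (dist m b) (dist m c)) < \<rho>" "\<rho> < R"
      using dense[of "max (dist m a) (max (dist m b) (dist m c))" R] m by auto
    then have "(m, \<rho>) \<in> UNIV \<times> {..<R}" "(a, b, c) \<in> W (m, \<rho>)"
      by (auto simp: W_def)
    then show "(a, b, c) \<in> (\<Union>i\<in>UNIV \<times> {..<R}. W i)" by blast
  qed
  moreover have "open (W i)" for i
    by (auto simp: W_def split_beta intro!: open_Times)
  moreover have "compact (K \<times> K \<times> K)"
    using \<open>compact K\<close> by (intro compact_Times)
  ultimately obtain C where C: "C \<subseteq> UNIV \<times> {..<R}" "finite C" "K \<times> K \<times> K \<subseteq> (\<Union>i\<in>C. W i)"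
    using compactE_image[of "K \<times> K \<times> K" "UNIV \<times> {..<R}" W] by metis
  \<comment> \<open>The element \<open>R - 1\<close> keeps the maximum defined when \<open>K\<close>, and with it \<open>C\<close>, may be empty.\<close>
  define \<rho> where "\<rho> = Max (insert (R - 1) (snd ` C))"
  have "\<rho> < R"
    using C(1,2) unfolding \<rho>_def by (subst Max_less_iff) auto
  moreover have "\<exists>m. \<forall>x\<in>{a, b, c}. dist m x \<le> \<rho>" if abc: "a \<in> K" "b \<in> K" "c \<in> K" for a b c
  proof -
    have "(a, b, c) \<in> (\<Union>i\<in>C. W i)"
      by (rule subsetD[OF C(3)]) (use abc in simp)
    then obtain m r where mr: "(m, r) \<in> C" "(a, b, c) \<in> W (m, r)"
      by auto
    then have "r \<le> \<rho>"
      unfolding \<rho>_def using C(2) by (intro Max_ge) (force intro: rev_image_eqI)+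
    with mr(2) show ?thesis
      by (intro exI[of _ m]) (auto simp: W_def)
  qed
  ultimately show ?thesis using that by blast
qed

text \<open>
  A point \<open>m\<close> with \<open>K \<subseteq> cball m \<rho>\<close> is a common point of the discs \<open>cball x \<rho>\<close>, \<open>x \<in> K\<close>. Helly's theorem
  provides one for finitely many discs, and compactness of the discs for all of them.
\<close>

lemma helly_cball_plane:
  fixes K :: "'a::euclidean_space set"
  assumes "DIM('a) = 2"
    and triples: "\<And>a b c. a \<in> K \<Longrightarrow> b \<in> K \<Longrightarrow> c \<in> K \<Longrightarrow> \<exists>m. \<forall>x\<in>{a, b, c}. dist m x \<le> \<rho>"
  shows "\<exists>m. K \<subseteq> cball m \<rho>"
proof -
  define F where "F = (\<lambda>x. cball x \<rho>) ` K"
  have small: "\<Inter>T \<noteq> {}" if T: "T \<subseteq> F" "card T \<le> 3" "finite T" for T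
  proof (cases "T = {}")
    case False
    then have "card T = 1 \<or> card T = 2 \<or> card T = 3"
      using T card_0_eq[OF \<open>finite T\<close>] by linarith
    \<comment> \<open>Families of one or two discs count as three with repetitions.\<close>
    then have "\<exists>A B C. T = {A, B, C}"
    proof (elim disjE)
      assume "card T = 1"
      then obtain A where "T = {A}" by (rule card_1_singletonE)
      then show ?thesis by (intro exI[of _ A]) simp
    next
      assume "card T = 2"
      then obtain A B where "T = {A, B}" by (auto simp: card_2_iff)
      then show ?thesis by (intro exI[of _ A] exI[of _ B]) simp
    next
      assume "card T = 3"
      then show ?thesis by (auto simp: card_3_iff)
    qed
    then obtain A B C where ABC: "T = {A, B, C}" by blast
    then obtain a b c where "a \<in> K" "b \<in> K" "c \<in> K"
      and eq: "A = cball a \<rho>" "B = cball b \<rho>" "C = cball c \<rho>"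
      using T(1) unfolding F_def by auto
    then obtain m where "\<forall>x\<in>{a, b, c}. dist m x \<le> \<rho>"
      using triples by blast
    then have "m \<in> \<Inter>T"
      by (simp add: ABC eq dist_commute)
    then show ?thesis by blast
  qed simp
  have "\<Inter>F \<noteq> {}"
  proof (rule compact_fip_Heine_Borel)
    show "compact S" if "S \<in> F" for S
      using that by (auto simp: F_def)
    show "\<Inter>T \<noteq> {}" if T: "finite T" "T \<subseteq> F" for T
    proof (cases "card T \<le> 3")
      case False
      show ?thesis
      proof (rule Helly)
        show "\<forall>S\<in>T. convex S"
          using T by (auto simp: F_def)
        show "\<Inter>S \<noteq> {}" if "S \<subseteq> T" "card S = DIM('a) + 1" for S
          using that T assms(1) by (intro small) (auto intro: finite_subset)
      qed (use False assms(1) in simp)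
    qed (use small T in blast)
  qed
  then obtain m where "m \<in> \<Inter>F" by blast
  then have "K \<subseteq> cball m \<rho>"
    by (auto simp: F_def dist_commute)
  then show ?thesis ..
qed

lemma frontier_in_small_ball:
  fixes E :: "(real^2) set"
  assumes E: "bounded E" "convex E" "interior E \<noteq> {}" "perimeter E = ennreal l" "l > 0"
  obtains m \<rho> where "\<rho> < l / 4" "frontier E \<subseteq> cball m \<rho>"
proof -
  have "compact (closure E)"
    using \<open>bounded E\<close> by (simp add: compact_closure)
  moreover have "\<exists>m. \<forall>x\<in>{a, b, c}. dist m x < l / 4"
    if "a \<in> closure E" "b \<in> closure E" "c \<in> closure E" for a b c
    using that by (intro three_points_in_small_ball[OF E]) auto
  ultimately obtain \<rho> where "\<rho> < l / 4" and
    "\<And>a b c. a \<in> closure E \<Longrightarrow> b \<in> closure E \<Longrightarrow> c \<in> closure E \<Longrightarrow> \<exists>m. \<forall>x\<in>{a, b, c}. dist m x \<le> \<rho>"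
    using uniform_triple_radius[of "closure E" "l/4"] by metis
  then obtain m where "closure E \<subseteq> cball m \<rho>"
    using helly_cball_plane[of "closure E" \<rho>] by auto
  then have "frontier E \<subseteq> cball m \<rho>"
    by (auto simp: frontier_def)
  then show ?thesis
    using that \<open>\<rho> < l / 4\<close> by blast
qed

section \<open>Total curvature and the upper bound\<close>

lemma space_curvature_measure [simp]: "space (curvature_measure E) = UNIV"
  and sets_curvature_measure [simp]: "sets (curvature_measure E) = sets borel"
proof -
  have "sigma_sets UNIV (sets borel) = sets (borel :: (real^2) measure)"
    using sets.sigma_sets_eq[of "borel :: (real^2) measure"] by simp
  then show "space (curvature_measure E) = UNIV" "sets (curvature_measure E) = sets borel"
    unfolding curvature_measure_def space_measure_of_conv sets_measure_of_conv by simp_all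
qed

text \<open>
  The measure of \<open>A\<close> is either the length of a set of unit vectors or, by the default of
  \<^const>\<open>measure_of\<close> for set functions that are not countably additive, zero.
\<close>

lemma emeasure_curvature_measure_le: "emeasure (curvature_measure E) A \<le> ennreal (2 * pi)"
proof -
  have "emeasure (curvature_measure E) A \<le> hausdorff1 (\<Union>x\<in>A \<inter> frontier E. outer_normals E x)"
    unfolding curvature_measure_def emeasure_measure_of_conv by simp
  also have "\<dots> \<le> hausdorff1 (sphere 0 1 :: (real^2) set)"
    by (intro hausdorff1_mono) (auto simp: outer_normals_def)
  finally show ?thesis
    using hausdorff1_unit_circle_le by (rule order_trans)
qed

text \<open>
  Every point of \<open>frontier E\<close> is within \<open>\<rho> < l / 4\<close> of one point \<open>m\<close>, so the integral about \<open>m\<close> is at most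
  \<open>\<rho>\<^sup>2\<close> times the total mass \<open>2 \<pi>\<close>.
\<close>

lemma curvature_moment_less:
  fixes E :: "(real^2) set"
  assumes E: "bounded E" "convex E" "interior E \<noteq> {}" "perimeter E = ennreal l" "l > 0"
  shows "(INF x\<^sub>0. \<integral>\<^sup>+x\<in>frontier E. ennreal ((norm (x - x\<^sub>0))\<^sup>2) \<partial>curvature_measure E)
           < ennreal (pi / 8 * l\<^sup>2)"
proof -
  obtain m \<rho> where \<rho>: "\<rho> < l / 4" and m: "frontier E \<subseteq> cball m \<rho>"
    using frontier_in_small_ball[OF E] by metis
  define r where "r = max 0 \<rho>"
  have r: "0 \<le> r" "r < l / 4"
    using \<rho> \<open>l > 0\<close> by (auto simp: r_def)
  have "(INF x\<^sub>0. \<integral>\<^sup>+x\<in>frontier E. ennreal ((norm (x - x\<^sub>0))\<^sup>2) \<partial>curvature_measure E)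
      \<le> (\<integral>\<^sup>+x\<in>frontier E. ennreal ((norm (x - m))\<^sup>2) \<partial>curvature_measure E)"
    by (rule INF_lower) simp
  also have "\<dots> \<le> (\<integral>\<^sup>+x. ennreal (r\<^sup>2) \<partial>curvature_measure E)"
  proof (rule nn_integral_mono)
    fix x
    show "ennreal ((norm (x - m))\<^sup>2) * indicator (frontier E) x \<le> ennreal (r\<^sup>2)"
    proof (cases "x \<in> frontier E")
      case True
      then have "norm (x - m) \<le> r"
        using subsetD[OF m True] by (simp add: r_def dist_norm norm_minus_commute)
      then show ?thesis
        using True by (simp add: ennreal_leI power_mono)
    qed simp
  qed
  also have "\<dots> = ennreal (r\<^sup>2) * emeasure (curvature_measure E) UNIV"
    by (simp add: nn_integral_const)
  also have "\<dots> \<le> ennreal (r\<^sup>2) * ennreal (2 * pi)"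
    by (intro mult_left_mono emeasure_curvature_measure_le) simp
  also have "\<dots> = ennreal (r\<^sup>2 * (2 * pi))"
    by (simp add: ennreal_mult)
  also have "\<dots> < ennreal (pi / 8 * l\<^sup>2)"
  proof (rule ennreal_lessI)
    have "r\<^sup>2 < (l / 4)\<^sup>2"
      using r by (intro power_strict_mono) auto
    then have "r\<^sup>2 * (2 * pi) < (l / 4)\<^sup>2 * (2 * pi)"
      by (intro mult_strict_right_mono) auto
    then show "r\<^sup>2 * (2 * pi) < pi / 8 * l\<^sup>2"
      by (simp add: power_divide field_simps)
  qed (use \<open>l > 0\<close> in simp)
  finally show ?thesis .
qed

section \<open>Rectangles\<close>

definition rectangle :: "real \<Rightarrow> real \<Rightarrow> (real^2) set" where
  "rectangle w h = {x. \<bar>x $ 1\<bar> \<le> w \<and> \<bar>x $ 2\<bar> \<le> h}"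

lemma rectangle_eq_cbox: "rectangle w h = cbox (vector [-w, -h]) (vector [w, h])"
  by (auto simp: rectangle_def mem_box_cart forall_2 abs_le_iff)

lemma interior_rectangle: "interior (rectangle w h) = {x. \<bar>x $ 1\<bar> < w \<and> \<bar>x $ 2\<bar> < h}"
  by (auto simp: rectangle_eq_cbox interior_cbox mem_box_cart forall_2 abs_less_iff)

lemma frontier_rectangle:
  "frontier (rectangle w h) = {x. \<bar>x $ 1\<bar> \<le> w \<and> \<bar>x $ 2\<bar> \<le> h \<and> (\<bar>x $ 1\<bar> = w \<or> \<bar>x $ 2\<bar> = h)}"
proof -
  have "closure (rectangle w h) = rectangle w h"
    by (simp add: rectangle_eq_cbox closure_closed)
  then show ?thesis
    unfolding frontier_def interior_rectangle by (auto simp: rectangle_def)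
qed

text \<open>
  The boundary is parametrized by the four sides; the index records whether a side is horizontal and the
  sign of the coordinate that is constant on it.
\<close>

lemma perimeter_rectangle:
  assumes "w > 0" "h > 0"
  shows "perimeter (rectangle w h) = ennreal (4 * (w + h))"
proof -
  define I where "I = {(True, 1::real), (True, -1), (False, 1), (False, -1)}"
  define L where "L = (\<lambda>(b, \<sigma>::real). if b then 2 * w else 2 * h)"
  define \<gamma> :: "bool \<times> real \<Rightarrow> real \<Rightarrow> real^2" where
    "\<gamma> = (\<lambda>(b, \<sigma>) r. if b then vector [-w, \<sigma> * h] + r *\<^sub>R vector [1, 0]
                          else vector [\<sigma> * w, -h] + r *\<^sub>R vector [0, 1])"
  have \<gamma>_nth: "\<gamma> (b, \<sigma>) r $ 1 = (if b then r - w else \<sigma> * w)"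
       "\<gamma> (b, \<sigma>) r $ 2 = (if b then \<sigma> * h else r - h)" for b \<sigma> r
    by (auto simp: \<gamma>_def)
  have norms: "norm (vector [1, 0] :: real^2) = 1" "norm (vector [0, 1] :: real^2) = 1"
    by (simp_all add: norm_vec_def L2_set_def sum_2)
  have sides: "(\<Union>i\<in>I. \<gamma> i ` {0..L i}) = frontier (rectangle w h)"
  proof (intro equalityI subsetI)
    fix x assume "x \<in> (\<Union>i\<in>I. \<gamma> i ` {0..L i})"
    then show "x \<in> frontier (rectangle w h)"
      using assms by (auto simp: frontier_rectangle I_def L_def \<gamma>_nth abs_le_iff)
  next
    fix x assume x: "x \<in> frontier (rectangle w h)"
    then have bd: "\<bar>x $ 1\<bar> \<le> w" "\<bar>x $ 2\<bar> \<le> h"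
      by (auto simp: frontier_rectangle)
    obtain b \<sigma> where b\<sigma>: "(b, \<sigma>) \<in> I" "if b then x $ 2 = \<sigma> * h else x $ 1 = \<sigma> * w"
    proof -
      have "x $ 2 = h \<or> x $ 2 = - h \<or> x $ 1 = w \<or> x $ 1 = - w"
        using x by (auto simp: frontier_rectangle)
      then show ?thesis
        using that[of True 1] that[of True "-1"] that[of False 1] that[of False "-1"] by (auto simp: I_def)
    qed
    define r where "r = (if b then x $ 1 + w else x $ 2 + h)"
    have "x = \<gamma> (b, \<sigma>) r"
      using b\<sigma>(2) by (auto simp: vec_eq_iff forall_2 \<gamma>_nth r_def)
    moreover have "r \<in> {0..L (b, \<sigma>)}"
      using bd by (auto simp: r_def L_def)
    ultimately show "x \<in> (\<Union>i\<in>I. \<gamma> i ` {0..L i})"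
      using b\<sigma>(1) by blast
  qed
  have "hausdorff1 (\<Union>i\<in>I. \<gamma> i ` {0..L i}) = ennreal (\<Sum>i\<in>I. L i)"
  proof (rule hausdorff1_UN_arcs_eq)
    show "hausdorff1 (\<gamma> i ` {s..t}) = ennreal (t - s)" if "s \<le> t" for i s t
      using that hausdorff1_segment norms by (cases i) (auto simp: \<gamma>_def)
    show "continuous_on {0..L i} (\<gamma> i)" for i
      by (cases i; cases "fst i") (auto simp: \<gamma>_def intro!: continuous_intros)
    show "disjoint_family_on (\<lambda>i. \<gamma> i ` {0<..<L i}) I"
      using assms by (auto simp: disjoint_family_on_def I_def L_def vec_eq_iff forall_2 \<gamma>_nth)
  qed (use assms in \<open>auto simp: I_def L_def\<close>)
  also have "(\<Sum>i\<in>I. L i) = 4 * (w + h)"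
    by (simp add: I_def L_def)
  finally show ?thesis
    by (simp add: perimeter_def sides)
qed

definition corner_signs :: "(real \<times> real) set" where
  "corner_signs = {(1, 1), (1, -1), (-1, 1), (-1, -1)}"

definition corner :: "real \<Rightarrow> real \<Rightarrow> real \<times> real \<Rightarrow> real^2" where
  "corner w h = (\<lambda>(\<sigma>, \<tau>). vector [\<sigma> * w, \<tau> * h])"

definition quarter_circle :: "real \<times> real \<Rightarrow> (real^2) set" where
  "quarter_circle = (\<lambda>(\<sigma>, \<tau>). ellipse_pt \<sigma> \<tau> ` {0..pi / 2})"

lemma quarter_circle_eq:
  assumes "(\<sigma>, \<tau>) \<in> corner_signs"
  shows "quarter_circle (\<sigma>, \<tau>) = {u. norm u = 1 \<and> \<sigma> * u $ 1 \<ge> 0 \<and> \<tau> * u $ 2 \<ge> 0}"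
proof (intro equalityI subsetI)
  have signs: "\<sigma> * \<sigma> = 1" "\<tau> * \<tau> = 1"
    using assms by (auto simp: corner_signs_def)
  fix u :: "real^2"
  {
    assume "u \<in> quarter_circle (\<sigma>, \<tau>)"
    then obtain t where t: "0 \<le> t" "t \<le> pi / 2" "u = ellipse_pt \<sigma> \<tau> t"
      by (auto simp: quarter_circle_def)
    have "(norm u)\<^sup>2 = (cos t)\<^sup>2 + (sin t)\<^sup>2"
      using signs by (simp add: norm_plane t power_mult_distrib power2_eq_square[of \<sigma>] power2_eq_square[of \<tau>])
    then have "norm u = 1" by (simp add: power2_eq_1_iff) (smt (verit) norm_ge_zero)
    moreover have "\<sigma> * u $ 1 = cos t" "\<tau> * u $ 2 = sin t"
      using signs by (simp_all add: t flip: mult.assoc)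
    moreover have "cos t \<ge> 0" "sin t \<ge> 0"
      using t pi_ge_zero by (intro cos_ge_zero sin_ge_zero; linarith)+
    ultimately show "u \<in> {u. norm u = 1 \<and> \<sigma> * u $ 1 \<ge> 0 \<and> \<tau> * u $ 2 \<ge> 0}" by simp
  next
    assume u: "u \<in> {u. norm u = 1 \<and> \<sigma> * u $ 1 \<ge> 0 \<and> \<tau> * u $ 2 \<ge> 0}"
    then have "(\<sigma> * u $ 1)\<^sup>2 + (\<tau> * u $ 2)\<^sup>2 = 1"
      using norm_plane[of u] signs by (simp add: power_mult_distrib power2_eq_square[of \<sigma>] power2_eq_square[of \<tau>])
    then obtain t where t: "0 \<le> t" "t \<le> pi / 2" "\<sigma> * u $ 1 = cos t" "\<tau> * u $ 2 = sin t"
      using sincos_total_pi_half[of "\<sigma> * u $ 1" "\<tau> * u $ 2"] u by auto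
    have "u $ 1 = \<sigma> * cos t" "u $ 2 = \<tau> * sin t"
      using signs by (simp_all flip: t(3,4) mult.assoc)
    then have "u = ellipse_pt \<sigma> \<tau> t"
      by (simp add: vec_eq_iff forall_2)
    then show "u \<in> quarter_circle (\<sigma>, \<tau>)"
      using t by (auto simp: quarter_circle_def)
  }
qed

text \<open>
  Distinct quarters share at most endpoints, since in the open quarters the signs of the coordinates
  determine the index.
\<close>

lemma hausdorff1_quarter_circles:
  assumes "J \<subseteq> corner_signs"
  shows "hausdorff1 (\<Union>i\<in>J. quarter_circle i) = ennreal (card J * (pi / 2))"
proof -
  have fin: "finite J"
    using assms by (rule finite_subset) (simp add: corner_signs_def)
  have signs: "(fst i)\<^sup>2 = 1" "(snd i)\<^sup>2 = 1" if "i \<in> J" for i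
    using that assms by (auto simp: corner_signs_def)
  have "hausdorff1 (\<Union>i\<in>J. (\<lambda>t. ellipse_pt (fst i) (snd i) t) ` {0..pi / 2}) = ennreal (\<Sum>i\<in>J. pi / 2)"
  proof (rule hausdorff1_UN_arcs_eq[OF fin])
    show "hausdorff1 ((\<lambda>t. ellipse_pt (fst i) (snd i) t) ` {s..t}) = ennreal (t - s)"
      if "i \<in> J" "0 \<le> s" "s \<le> t" "t \<le> pi / 2" for i s t
      using hausdorff1_circle_arc[OF signs[OF that(1)] that(3)] that by simp
    have lip: "dist (ellipse_pt (fst i) (snd i) x) (ellipse_pt (fst i) (snd i) y) \<le> dist x y" if "i \<in> J" for i x y
      using abs_sin_x_le_abs_x[of "(x - y) / 2"] by (simp add: dist_ellipse_pt signs[OF that] dist_real_def)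
    show "continuous_on {0..pi / 2} (\<lambda>t. ellipse_pt (fst i) (snd i) t)" if "i \<in> J" for i
      using lip[OF that] by (auto simp: continuous_on_iff intro: le_less_trans)
    have "i = j" if ij: "i \<in> J" "j \<in> J" and st: "s \<in> {0<..<pi / 2}" "t \<in> {0<..<pi / 2}"
      and eq: "ellipse_pt (fst i) (snd i) s = ellipse_pt (fst j) (snd j) t" for i j s t
    proof -
      have "cos s > 0" "cos t > 0" "sin s > 0" "sin t > 0"
        using st pi_gt_zero by (auto intro!: cos_gt_zero sin_gt_zero)
      moreover have "fst i * cos s = fst j * cos t" "snd i * sin s = snd j * sin t"
        using arg_cong[OF eq, of "\<lambda>x. x $ 1"] arg_cong[OF eq, of "\<lambda>x. x $ 2"] by simp_all
      moreover have "fst i \<in> {1, -1}" "snd i \<in> {1, -1}" "fst j \<in> {1, -1}" "snd j \<in> {1, -1}"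
        using ij assms by (auto simp: corner_signs_def)
      ultimately show "i = j"
        by (auto simp: prod_eq_iff)
    qed
    then show "disjoint_family_on (\<lambda>i. (\<lambda>t. ellipse_pt (fst i) (snd i) t) ` {0<..<pi / 2}) J"
      unfolding disjoint_family_on_def by blast
  qed auto
  then show ?thesis
    by (simp add: quarter_circle_def split_beta)
qed

text \<open>
  Testing a normal against the two adjacent corners gives its signs. Conversely, these signs make both
  coordinate terms of the inner product nonpositive.
\<close>

lemma outer_normals_corner:
  assumes "w > 0" "h > 0" "i \<in> corner_signs"
  shows "outer_normals (rectangle w h) (corner w h i) = quarter_circle i"
proof (cases i)
  case (Pair \<sigma> \<tau>)
  have \<sigma>\<tau>: "\<sigma> = 1 \<or> \<sigma> = -1" "\<tau> = 1 \<or> \<tau> = -1"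
    using assms(3) Pair by (auto simp: corner_signs_def)
  have "(\<forall>y\<in>rectangle w h. u \<bullet> (y - corner w h i) \<le> 0) \<longleftrightarrow> \<sigma> * u $ 1 \<ge> 0 \<and> \<tau> * u $ 2 \<ge> 0" for u
  proof
    assume *: "\<forall>y\<in>rectangle w h. u \<bullet> (y - corner w h i) \<le> 0"
    have "vector [- \<sigma> * w, \<tau> * h] \<in> rectangle w h" "vector [\<sigma> * w, - \<tau> * h] \<in> rectangle w h"
      using \<sigma>\<tau> assms by (auto simp: rectangle_def)
    from this[THEN *[THEN bspec]] have "- 2 * w * (\<sigma> * u $ 1) \<le> 0" "- 2 * h * (\<tau> * u $ 2) \<le> 0"
      by (simp_all add: inner_vec_def sum_2 corner_def Pair algebra_simps)
    then show "\<sigma> * u $ 1 \<ge> 0 \<and> \<tau> * u $ 2 \<ge> 0"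
      using assms by (simp add: zero_le_mult_iff)
  next
    assume *: "\<sigma> * u $ 1 \<ge> 0 \<and> \<tau> * u $ 2 \<ge> 0"
    show "\<forall>y\<in>rectangle w h. u \<bullet> (y - corner w h i) \<le> 0"
    proof
      fix y assume y: "y \<in> rectangle w h"
      have "(\<sigma> * u $ 1) * (\<sigma> * y $ 1 - w) \<le> 0" "(\<tau> * u $ 2) * (\<tau> * y $ 2 - h) \<le> 0"
        using * y \<sigma>\<tau> by (auto intro!: mult_nonneg_nonpos simp: rectangle_def)
      moreover have "u \<bullet> (y - corner w h i) = (\<sigma> * u $ 1) * (\<sigma> * y $ 1 - w) + (\<tau> * u $ 2) * (\<tau> * y $ 2 - h)"
        using \<sigma>\<tau> by (auto simp: inner_vec_def sum_2 corner_def Pair algebra_simps)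
      ultimately show "u \<bullet> (y - corner w h i) \<le> 0" by simp
    qed
  qed
  then show ?thesis
    using quarter_circle_eq[of \<sigma> \<tau>] assms(3) Pair by (simp add: outer_normals_def)
qed

definition axis_directions :: "(real^2) set" where
  "axis_directions = {vector [1, 0], vector [-1, 0], vector [0, 1], vector [0, -1]}"

text \<open>
  At such a point one coordinate can be varied in both directions inside the rectangle, so the normal
  vanishes in that coordinate.
\<close>

lemma outer_normals_side:
  assumes "x \<in> frontier (rectangle w h)" "x \<notin> corner w h ` corner_signs"
  shows "outer_normals (rectangle w h) x \<subseteq> axis_directions"
proof
  fix u assume "u \<in> outer_normals (rectangle w h) x"
  then have u: "norm u = 1" "\<And>y. y \<in> rectangle w h \<Longrightarrow> u \<bullet> (y - x) \<le> 0"
    by (auto simp: outer_normals_def)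
  have x: "\<bar>x $ 1\<bar> \<le> w" "\<bar>x $ 2\<bar> \<le> h"
    using assms(1) by (auto simp: frontier_rectangle)
  have "\<bar>x $ 1\<bar> < w \<or> \<bar>x $ 2\<bar> < h"
  proof (rule ccontr)
    assume "\<not> ?thesis"
    then have "\<bar>x $ 1\<bar> = w" "\<bar>x $ 2\<bar> = h" using x by auto
    then have "x = corner w h (if x $ 1 \<ge> 0 then 1 else -1, if x $ 2 \<ge> 0 then 1 else -1)"
      by (auto simp: vec_eq_iff forall_2 corner_def)
    then have "x \<in> corner w h ` corner_signs"
      by (rule image_eqI) (auto simp: corner_signs_def)
    then show False using assms(2) by simp
  qed
  then have "u $ 1 = 0 \<or> u $ 2 = 0"
  proof
    assume *: "\<bar>x $ 1\<bar> < w"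
    have "vector [w, x $ 2] \<in> rectangle w h" "vector [- w, x $ 2] \<in> rectangle w h"
      using x by (auto simp: rectangle_def)
    from this[THEN u(2)] have "u $ 1 * (w - x $ 1) \<le> 0" "u $ 1 * (- w - x $ 1) \<le> 0"
      by (simp_all add: inner_vec_def sum_2)
    then have "u $ 1 = 0"
      using * by (auto simp: mult_le_0_iff)
    then show ?thesis ..
  next
    assume *: "\<bar>x $ 2\<bar> < h"
    have "vector [x $ 1, h] \<in> rectangle w h" "vector [x $ 1, - h] \<in> rectangle w h"
      using x by (auto simp: rectangle_def)
    from this[THEN u(2)] have "u $ 2 * (h - x $ 2) \<le> 0" "u $ 2 * (- h - x $ 2) \<le> 0"
      by (simp_all add: inner_vec_def sum_2)
    then have "u $ 2 = 0"
      using * by (auto simp: mult_le_0_iff)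
    then show ?thesis ..
  qed
  then show "u \<in> axis_directions"
    using norm_plane[of u] u(1) by (auto simp: axis_directions_def vec_eq_iff forall_2 power2_eq_1_iff)
qed

text \<open>
  The corners in \<open>A\<close> contribute their quarter circles; all other boundary points together contribute
  at most four vectors, a null set.
\<close>

lemma hausdorff1_normals_rectangle:
  assumes "w > 0" "h > 0"
  shows "hausdorff1 (\<Union>x\<in>A \<inter> frontier (rectangle w h). outer_normals (rectangle w h) x)
       = ennreal (pi / 2) * card {i \<in> corner_signs. corner w h i \<in> A}"
proof -
  define J where "J = {i \<in> corner_signs. corner w h i \<in> A}"
  let ?N = "\<Union>x\<in>A \<inter> frontier (rectangle w h). outer_normals (rectangle w h) x"
  have J: "J \<subseteq> corner_signs" by (auto simp: J_def)
  have "?N \<subseteq> (\<Union>i\<in>J. quarter_circle i) \<union> axis_directions"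
  proof
    fix u assume "u \<in> ?N"
    then obtain x where x: "x \<in> A" "x \<in> frontier (rectangle w h)" "u \<in> outer_normals (rectangle w h) x"
      by auto
    show "u \<in> (\<Union>i\<in>J. quarter_circle i) \<union> axis_directions"
    proof (cases "x \<in> corner w h ` corner_signs")
      case True
      then obtain i where i: "i \<in> corner_signs" "x = corner w h i" by blast
      then have "i \<in> J" "u \<in> quarter_circle i"
        using x outer_normals_corner[OF assms i(1)] by (auto simp: J_def)
      then show ?thesis by blast
    next
      case False
      then show ?thesis
        using outer_normals_side[OF x(2) False] x(3) by blast
    qed
  qed
  then have "hausdorff1 ?N \<le> hausdorff1 ((\<Union>i\<in>J. quarter_circle i) \<union> axis_directions)"
    by (rule hausdorff1_mono)
  also have "\<dots> \<le> hausdorff1 (\<Union>i\<in>J. quarter_circle i) + hausdorff1 axis_directions"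
    by (rule hausdorff1_Un_le)
  also have "hausdorff1 axis_directions = 0"
    by (rule hausdorff1_finite) (simp add: axis_directions_def)
  finally have "hausdorff1 ?N \<le> hausdorff1 (\<Union>i\<in>J. quarter_circle i)" by simp
  moreover have "(\<Union>i\<in>J. quarter_circle i) \<subseteq> ?N"
  proof
    fix u assume "u \<in> (\<Union>i\<in>J. quarter_circle i)"
    then obtain i where i: "i \<in> corner_signs" "corner w h i \<in> A" "u \<in> quarter_circle i"
      by (auto simp: J_def)
    moreover have "corner w h i \<in> frontier (rectangle w h)"
      using i(1) assms by (auto simp: frontier_rectangle corner_def corner_signs_def)
    ultimately show "u \<in> ?N"
      using outer_normals_corner[OF assms i(1)] by blast
  qed
  then have "hausdorff1 (\<Union>i\<in>J. quarter_circle i) \<le> hausdorff1 ?N"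
    by (rule hausdorff1_mono)
  ultimately have "hausdorff1 ?N = ennreal (card J * (pi / 2))"
    using hausdorff1_quarter_circles[OF J] by simp
  then show ?thesis
    by (simp only: J_def ennreal_of_nat_eq_real_of_nat mult.commute ennreal_mult' pi_half_ge_zero)
qed

text \<open>
  Identifying the set function with an existing measure, point masses \<open>pi / 2\<close> at the corners, settles
  countable additivity and turns integrals into finite sums.
\<close>

lemma curvature_measure_rectangle:
  assumes "w > 0" "h > 0"
  shows "curvature_measure (rectangle w h)
       = distr (scale_measure (ennreal (pi / 2)) (count_space corner_signs)) borel (corner w h)"
    (is "_ = ?D")
proof -
  have fin: "finite corner_signs" by (simp add: corner_signs_def)
  have meas: "corner w h \<in> measurable (scale_measure (ennreal (pi / 2)) (count_space corner_signs)) borel"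
    by simp
  have "emeasure ?D A = ennreal (pi / 2) * card {i \<in> corner_signs. corner w h i \<in> A}"
    if "A \<in> sets borel" for A
  proof -
    have "corner w h -` A \<inter> corner_signs = {i \<in> corner_signs. corner w h i \<in> A}" by auto
    then show ?thesis
      using that fin by (simp add: emeasure_distr[OF meas] space_scale_measure)
  qed
  then have "curvature_measure (rectangle w h) = measure_of (space ?D) (sets ?D) (emeasure ?D)"
    unfolding curvature_measure_def
    by (simp add: hausdorff1_normals_rectangle[OF assms])
      (intro measure_of_eq, use sets.sigma_sets_eq[of "borel :: (real^2) measure"] in auto)
  then show ?thesis
    by (simp only: measure_of_of_measure)
qed

lemma moment_rectangle:
  assumes "w > 0" "h > 0"
  shows "(\<integral>\<^sup>+x\<in>frontier (rectangle w h). ennreal ((norm (x - x\<^sub>0))\<^sup>2) \<partial>curvature_measure (rectangle w h))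
       = ennreal (pi / 2 * (\<Sum>i\<in>corner_signs. (norm (corner w h i - x\<^sub>0))\<^sup>2))"
proof -
  let ?g = "\<lambda>x. ennreal ((norm (x - x\<^sub>0))\<^sup>2) * indicator (frontier (rectangle w h)) x"
  have "?g \<in> borel_measurable borel"
    by (intro borel_measurable_times_ennreal borel_measurable_indicator borel_closed frontier_closed)
      measurable
  then have "(\<integral>\<^sup>+x. ?g x \<partial>curvature_measure (rectangle w h))
      = (\<integral>\<^sup>+i. ?g (corner w h i) \<partial>scale_measure (ennreal (pi / 2)) (count_space corner_signs))"
    unfolding curvature_measure_rectangle[OF assms] by (intro nn_integral_distr) simp_all
  also have "\<dots> = ennreal (pi / 2) * (\<Sum>i\<in>corner_signs. ?g (corner w h i))"
    by (simp add: nn_integral_scale_measure nn_integral_count_space_finite corner_signs_def)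
  also have "(\<Sum>i\<in>corner_signs. ?g (corner w h i)) = (\<Sum>i\<in>corner_signs. ennreal ((norm (corner w h i - x\<^sub>0))\<^sup>2))"
  proof (rule sum.cong[OF refl])
    fix i assume "i \<in> corner_signs"
    then have "corner w h i \<in> frontier (rectangle w h)"
      using assms by (auto simp: frontier_rectangle corner_def corner_signs_def)
    then show "?g (corner w h i) = ennreal ((norm (corner w h i - x\<^sub>0))\<^sup>2)" by simp
  qed
  also have "\<dots> = ennreal (\<Sum>i\<in>corner_signs. (norm (corner w h i - x\<^sub>0))\<^sup>2)"
    by (simp add: sum_ennreal)
  finally show ?thesis
    by (simp only: ennreal_mult' pi_half_ge_zero)
qed

text \<open>
  The mixed terms cancel by central symmetry, so moving \<open>x\<^sub>0\<close> away from the centre only increases the sum.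
\<close>

lemma moment_rectangle_ge:
  assumes "w > 0" "h > 0"
  shows "ennreal (2 * pi * w\<^sup>2)
    \<le> (INF x\<^sub>0. \<integral>\<^sup>+x\<in>frontier (rectangle w h). ennreal ((norm (x - x\<^sub>0))\<^sup>2) \<partial>curvature_measure (rectangle w h))"
proof (rule INF_greatest)
  fix x\<^sub>0 :: "real^2"
  have "(\<Sum>i\<in>corner_signs. (norm (corner w h i - x\<^sub>0))\<^sup>2) = 4 * (w\<^sup>2 + h\<^sup>2 + (x\<^sub>0 $ 1)\<^sup>2 + (x\<^sub>0 $ 2)\<^sup>2)"
    by (simp add: corner_signs_def corner_def norm_plane power2_diff power_mult_distrib)
  then have "4 * w\<^sup>2 \<le> (\<Sum>i\<in>corner_signs. (norm (corner w h i - x\<^sub>0))\<^sup>2)" by simp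
  then have "pi / 2 * (4 * w\<^sup>2) \<le> pi / 2 * (\<Sum>i\<in>corner_signs. (norm (corner w h i - x\<^sub>0))\<^sup>2)"
    by (rule mult_left_mono) simp
  then show "ennreal (2 * pi * w\<^sup>2)
    \<le> (\<integral>\<^sup>+x\<in>frontier (rectangle w h). ennreal ((norm (x - x\<^sub>0))\<^sup>2) \<partial>curvature_measure (rectangle w h))"
    unfolding moment_rectangle[OF assms] by (intro ennreal_leI) simp
qed

section \<open>The sharp constant\<close>

theorem proposition3p9:
  fixes l :: real
  assumes "l > 0"
  shows "(\<forall>E :: (real^2) set.
            bounded E \<and> convex E \<and> interior E \<noteq> {} \<and> perimeter E = ennreal l \<longrightarrow>
            (INF x\<^sub>0. \<integral>\<^sup>+x\<in>frontier E. ennreal ((norm (x - x\<^sub>0))\<^sup>2) \<partial>curvature_measure E)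
              < ennreal (pi / 8 * l\<^sup>2)) \<and>
         (SUP E\<in>{E :: (real^2) set.
                   bounded E \<and> convex E \<and> interior E \<noteq> {} \<and> perimeter E = ennreal l}.
            INF x\<^sub>0. \<integral>\<^sup>+x\<in>frontier E. ennreal ((norm (x - x\<^sub>0))\<^sup>2) \<partial>curvature_measure E)
           = ennreal (pi / 8 * l\<^sup>2)"
proof -
  define moment :: "(real^2) set \<Rightarrow> ennreal" where
    "moment E = (INF x\<^sub>0. \<integral>\<^sup>+x\<in>frontier E. ennreal ((norm (x - x\<^sub>0))\<^sup>2) \<partial>curvature_measure E)" for E
  define \<C> where "\<C> = {E :: (real^2) set. bounded E \<and> convex E \<and> interior E \<noteq> {} \<and> perimeter E = ennreal l}"
  have less: "moment E < ennreal (pi / 8 * l\<^sup>2)" if "E \<in> \<C>" for E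
    using curvature_moment_less[of E l] that \<open>l > 0\<close> by (auto simp: \<C>_def moment_def)
  have ge: "ennreal (2 * pi * w\<^sup>2) \<le> (SUP E\<in>\<C>. moment E)" if "0 < w" "w < l / 4" for w
  proof -
    define h where "h = l / 4 - w"
    have "h > 0" using that by (simp add: h_def)
    have "0 \<in> interior (rectangle w h)"
      using that \<open>h > 0\<close> by (simp add: interior_rectangle)
    moreover have "perimeter (rectangle w h) = ennreal l"
      using perimeter_rectangle[OF \<open>0 < w\<close> \<open>h > 0\<close>] by (simp add: h_def)
    ultimately have "rectangle w h \<in> \<C>"
      unfolding \<C>_def by (auto simp: rectangle_eq_cbox bounded_cbox convex_box)
    then have "moment (rectangle w h) \<le> (SUP E\<in>\<C>. moment E)"
      by (rule SUP_upper)
    with moment_rectangle_ge[OF \<open>0 < w\<close> \<open>h > 0\<close>] show ?thesis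
      unfolding moment_def by (rule order_trans)
  qed
  have "(SUP E\<in>\<C>. moment E) = ennreal (pi / 8 * l\<^sup>2)"
  proof (rule antisym)
    show "(SUP E\<in>\<C>. moment E) \<le> ennreal (pi / 8 * l\<^sup>2)"
      using less by (intro SUP_least) (auto intro: less_imp_le)
    have "0 < l / 4" using \<open>l > 0\<close> by simp
    have "((\<lambda>w. ennreal (2 * pi * w\<^sup>2)) \<longlongrightarrow> ennreal (2 * pi * (l / 4)\<^sup>2)) (at_left (l / 4))"
      by (intro tendsto_intros)
    moreover have "eventually (\<lambda>w. ennreal (2 * pi * w\<^sup>2) \<le> (SUP E\<in>\<C>. moment E)) (at_left (l / 4))"
      unfolding eventually_at_left[OF \<open>0 < l / 4\<close>] using ge \<open>l > 0\<close> by (intro exI[of _ 0]) auto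
    ultimately have "ennreal (2 * pi * (l / 4)\<^sup>2) \<le> (SUP E\<in>\<C>. moment E)"
      by (intro tendsto_upperbound) auto
    moreover have "2 * pi * (l / 4)\<^sup>2 = pi / 8 * l\<^sup>2"
      by (simp add: power_divide)
    ultimately show "ennreal (pi / 8 * l\<^sup>2) \<le> (SUP E\<in>\<C>. moment E)"
      by simp
  qed
  with less show ?thesis
    unfolding \<C>_def moment_def by blast
qed

end
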